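(* Let $\mathbf{E}\subseteq\mathbf{A}$ be finite symmetric integral relation algebras such that $\mathbf{A}$ is a special extension of $\mathbf{E}$ and $\mathbf{E}$ has a flexible trio. Let $\mathbf{B}$ be the subalgebra of $\mathbf{C}_{\mathbf{E}}(\mathbf{A})$ generated by the set of atoms of $\mathbf{C}_{\mathbf{E}}(\mathbf{A})$. Then: (i) every finitely generated subalgebra of $\mathbf{B}$ is contained in a subalgebra of $\mathbf{B}$ that has the 1-point extension property; (ii) $\mathbf{B}$ is representable; (iii) if $\mathbf{A}$ has no 1-cycles, i.e., $u;u\cdot u=0$ whenever $u$ is an atom of $\mathbf{A}$ with $u\neq 1'$, then $\mathbf{B}$ is not completely representable and the completion of $\mathbf{B}$ is not representable.
   Context: Relation algebras are in the sense of Tarski; $1'$ identity, $0'$ diversity element (complement of $1'$), $;$ relative product, $\overline{x}$ Boolean complement; integral means $1'$ is an atom, symmetric means $x^{\smile}=x$ for all $x$; a diversity atom is an atom below $0'$. A relation algebra is representable if isomorphic to an algebra of binary relations; a representation is complete if it preserves all existing joins; completely representable means having a complete representation. A completion of $\mathbf{B}$ is a complete algebra with $\mathbf{B}$ as a dense subalgebra. Special extension: $\mathbf{A}$ is a special extension of $\mathbf{E}$ if for all diversity atoms $a,b,c$ of $\mathbf{E}$: (1) if not $a=b=c$ and $a;b\ge c$, then $x;y\ge c$ whenever $x,y$ are atoms of $\mathbf{A}$ with $x\le a$, $y\le b$; (2) if $a;a\ge a$ then $x;y\cdot a\ne 0$ whenever $x,y$ are atoms of $\mathbf{A}$ below $a$.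 Flexible trio: diversity atoms $a,b,c$ of a symmetric integral relation algebra with $a;a=b;b=c;c=1$, $a;b=a;c=b;c=0'$, and for every atom $x\notin\{1',a,b,c\}$: ($x;a=x;b=0'$) or ($x;a=x;c=0'$) or ($x;b=x;c=0'$). The algebra $\mathbf{C}_{\mathbf{E}}(\mathbf{A})$: for each atom $x$ of $\mathbf{A}$ let $c(x)$ be the atom of $\mathbf{E}$ with $x\le c(x)$. Let $T(i,j,k)$ for $i,j,k\in\omega$ hold iff $(i\le j=k)$ or $(j\le k=i)$ or $(k\le i=j)$. Let $At=\{1'\}\cup\{x^{(i)}:x$ a diversity atom of $\mathbf{A}$, $i\in\omega\}$. Let $C\subseteq At^3$ consist of all permutations of $(1',1',1')$, $(1',x^{(i)},x^{(i)})$, and $(x^{(i)},y^{(j)},z^{(k)})$ where $x,y,z$ are diversity atoms of $\mathbf{A}$ with $x;y\ge z$ and, if $c(x)=c(y)=c(z)$, then $T(i,j,k)$. $\mathbf{C}_{\mathbf{E}}(\mathbf{A})$ is the algebra of all subsets of $At$ with set Boolean operations, identity $\{1'\}$, converse the identity map, and $X;Y=\{w:\exists u\in X,\exists v\in Y,(u,v,w)\in C\}$; its atoms are the elements of $At$. 1-point extension property (for an atomic relation algebra $\mathbf{A}$): $B_k(\mathbf{A})$ is the set of $\mu:k\times k\to At(\mathbf{A})$ with $\mu_{i,i}\le 1'$, $\mu_{i,j}^{\smile}=\mu_{j,i}$, $\mu_{i,l};\mu_{l,j}\ge\mu_{i,j}$ for all $i,j,l<k$; $\mu$ satisfies the identity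 condition if $\mu_{l,m}=1'$ iff $l=m$. $\mathbf{A}$ has the property if whenever $\mu\in B_k(\mathbf{A})$ satisfies the identity condition, $x,y$ are diversity atoms, $i\ne j<k$ and $\mu_{i,j}\le x;y$, there is $\mu'\in B_{k+1}(\mathbf{A})$ satisfying the identity condition, extending $\mu$, with $\mu'_{i,k}=x$ and $\mu'_{k,j}=y$. *)

theory Defs
  imports Main
begin

record 'a ra =
  car  :: "'a set"
  jn   :: "'a \<Rightarrow> 'a \<Rightarrow> 'a"   (* Boolean join + *)
  cm   :: "'a \<Rightarrow> 'a"         (* Boolean complement *)
  cp   :: "'a \<Rightarrow> 'a \<Rightarrow> 'a"   (* relative product ; *)
  cv   :: "'a \<Rightarrow> 'a"         (* converse *)
  idt  :: "'a"

definition ra_meet :: "('a, 'z) ra_scheme \<Rightarrow> 'a \<Rightarrow> 'a \<Rightarrow> 'a" where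
  "ra_meet A x y = cm A (jn A (cm A x) (cm A y))"

definition ra_zero :: "('a, 'z) ra_scheme \<Rightarrow> 'a" where
  "ra_zero A = ra_meet A (idt A) (cm A (idt A))"

definition ra_top :: "('a, 'z) ra_scheme \<Rightarrow> 'a" where
  "ra_top A = cm A (ra_zero A)"

definition ra_div :: "('a, 'z) ra_scheme \<Rightarrow> 'a" where
  "ra_div A = cm A (idt A)"

definition ra_le :: "('a, 'z) ra_scheme \<Rightarrow> 'a \<Rightarrow> 'a \<Rightarrow> bool" where
  "ra_le A x y \<longleftrightarrow> jn A x y = y"

text \<open>Tarski's axioms R1--R10 (Maddux's form), relativised to the carrier.\<close>
definition is_ra :: "('a, 'z) ra_scheme \<Rightarrow> bool" where
  "is_ra A \<longleftrightarrow>
     idt A \<in> car A \<and>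
     (\<forall>x\<in>car A. \<forall>y\<in>car A. jn A x y \<in> car A \<and> cp A x y \<in> car A) \<and>
     (\<forall>x\<in>car A. cm A x \<in> car A \<and> cv A x \<in> car A) \<and>
     (\<forall>x\<in>car A. \<forall>y\<in>car A. jn A x y = jn A y x) \<and>
     (\<forall>x\<in>car A. \<forall>y\<in>car A. \<forall>z\<in>car A. jn A x (jn A y z) = jn A (jn A x y) z) \<and>
     (\<forall>x\<in>car A. \<forall>y\<in>car A.
        jn A (cm A (jn A (cm A x) y)) (cm A (jn A (cm A x) (cm A y))) = x) \<and>
     (\<forall>x\<in>car A. \<forall>y\<in>car A. \<forall>z\<in>car A. cp A x (cp A y z) = cp A (cp A x y) z) \<and>
     (\<forall>x\<in>car A. \<forall>y\<in>car A. \<forall>z\<in>car A. cp A (jn A x y) z = jn A (cp A x z) (cp A y z)) \<and>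
     (\<forall>x\<in>car A. cp A x (idt A) = x) \<and>
     (\<forall>x\<in>car A. cv A (cv A x) = x) \<and>
     (\<forall>x\<in>car A. \<forall>y\<in>car A. cv A (jn A x y) = jn A (cv A x) (cv A y)) \<and>
     (\<forall>x\<in>car A. \<forall>y\<in>car A. cv A (cp A x y) = cp A (cv A y) (cv A x)) \<and>
     (\<forall>x\<in>car A. \<forall>y\<in>car A.
        jn A (cp A (cv A x) (cm A (cp A x y))) (cm A y) = cm A y)"

definition ra_atom :: "('a, 'z) ra_scheme \<Rightarrow> 'a \<Rightarrow> bool" where
  "ra_atom A x \<longleftrightarrow> x \<in> car A \<and> x \<noteq> ra_zero A \<and>
     (\<forall>y\<in>car A. ra_le A y x \<longrightarrow> y = ra_zero A \<or> y = x)"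

definition ra_atomic :: "('a, 'z) ra_scheme \<Rightarrow> bool" where
  "ra_atomic A \<longleftrightarrow> (\<forall>x\<in>car A. x \<noteq> ra_zero A \<longrightarrow> (\<exists>a. ra_atom A a \<and> ra_le A a x))"

definition div_atom :: "('a, 'z) ra_scheme \<Rightarrow> 'a \<Rightarrow> bool" where
  "div_atom A x \<longleftrightarrow> ra_atom A x \<and> ra_le A x (ra_div A)"

definition integral :: "('a, 'z) ra_scheme \<Rightarrow> bool" where
  "integral A \<longleftrightarrow> ra_atom A (idt A)"

definition symmetric :: "('a, 'z) ra_scheme \<Rightarrow> bool" where
  "symmetric A \<longleftrightarrow> (\<forall>x\<in>car A. cv A x = x)"

definition subalgebra :: "('a, 'z) ra_scheme \<Rightarrow> ('a, 'w) ra_scheme \<Rightarrow> bool" where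
  "subalgebra E A \<longleftrightarrow> car E \<subseteq> car A \<and> idt E = idt A \<and>
     (\<forall>x\<in>car E. \<forall>y\<in>car E. jn E x y = jn A x y \<and> cp E x y = cp A x y) \<and>
     (\<forall>x\<in>car E. cm E x = cm A x \<and> cv E x = cv A x) \<and>
     (\<forall>x\<in>car E. \<forall>y\<in>car E. jn A x y \<in> car E \<and> cp A x y \<in> car E) \<and>
     (\<forall>x\<in>car E. cm A x \<in> car E \<and> cv A x \<in> car E) \<and> idt A \<in> car E"

definition closed_sub :: "('a, 'z) ra_scheme \<Rightarrow> 'a set \<Rightarrow> bool" where
  "closed_sub A X \<longleftrightarrow> X \<subseteq> car A \<and> idt A \<in> X \<and>
     (\<forall>x\<in>X. \<forall>y\<in>X. jn A x y \<in> X \<and> cp A x y \<in> X) \<and>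
     (\<forall>x\<in>X. cm A x \<in> X \<and> cv A x \<in> X)"

definition gen_univ :: "('a, 'z) ra_scheme \<Rightarrow> 'a set \<Rightarrow> 'a set" where
  "gen_univ A S = \<Inter>{X. S \<subseteq> X \<and> closed_sub A X}"

definition restrict_ra :: "('a, 'z) ra_scheme \<Rightarrow> 'a set \<Rightarrow> ('a, 'z) ra_scheme" where
  "restrict_ra A X = A\<lparr>car := X\<rparr>"

definition special_extension :: "'a ra \<Rightarrow> 'a ra \<Rightarrow> bool" where
  "special_extension A E \<longleftrightarrow>
     (\<forall>a b c. div_atom E a \<and> div_atom E b \<and> div_atom E c \<longrightarrow>
        ((\<not>(a = b \<and> b = c) \<and> ra_le A c (cp A a b) \<longrightarrow>
            (\<forall>x y. ra_atom A x \<and> ra_atom A y \<and> ra_le A x a \<and> ra_le A y b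
                   \<longrightarrow> ra_le A c (cp A x y))) \<and>
         (ra_le A a (cp A a a) \<longrightarrow>
            (\<forall>x y. ra_atom A x \<and> ra_atom A y \<and> ra_le A x a \<and> ra_le A y a
                   \<longrightarrow> ra_meet A (cp A x y) a \<noteq> ra_zero A))))"

definition flexible_trio :: "'a ra \<Rightarrow> 'a \<Rightarrow> 'a \<Rightarrow> 'a \<Rightarrow> bool" where
  "flexible_trio E a b c \<longleftrightarrow>
     div_atom E a \<and> div_atom E b \<and> div_atom E c \<and>
     cp E a a = ra_top E \<and> cp E b b = ra_top E \<and> cp E c c = ra_top E \<and>
     cp E a b = ra_div E \<and> cp E a c = ra_div E \<and> cp E b c = ra_div E \<and>
     (\<forall>x. ra_atom E x \<and> x \<notin> {idt E, a, b, c} \<longrightarrow>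
        (cp E x a = ra_div E \<and> cp E x b = ra_div E) \<or>
        (cp E x a = ra_div E \<and> cp E x c = ra_div E) \<or>
        (cp E x b = ra_div E \<and> cp E x c = ra_div E))"

definition has_flexible_trio :: "'a ra \<Rightarrow> bool" where
  "has_flexible_trio E \<longleftrightarrow> (\<exists>a b c. flexible_trio E a b c)"

definition cE :: "'a ra \<Rightarrow> 'a ra \<Rightarrow> 'a \<Rightarrow> 'a" where
  "cE E A x = (THE e. ra_atom E e \<and> ra_le A x e)"

definition T3 :: "nat \<Rightarrow> nat \<Rightarrow> nat \<Rightarrow> bool" where
  "T3 i j k \<longleftrightarrow> (i \<le> j \<and> j = k) \<or> (j \<le> k \<and> k = i) \<or> (k \<le> i \<and> i = j)"

text \<open>Atoms of C_E(A): None stands for 1', Some (x,i) for x^(i).\<close>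
definition CAt :: "'a ra \<Rightarrow> ('a \<times> nat) option set" where
  "CAt A = {None} \<union> {Some (x, i) | x i. div_atom A x}"

definition Cbase :: "'a ra \<Rightarrow> 'a ra \<Rightarrow> ('a \<times> nat) option \<Rightarrow> ('a \<times> nat) option
                       \<Rightarrow> ('a \<times> nat) option \<Rightarrow> bool" where
  "Cbase E A u v w \<longleftrightarrow>
     (u = None \<and> v = None \<and> w = None) \<or>
     (\<exists>x i. div_atom A x \<and> u = None \<and> v = Some (x, i) \<and> w = Some (x, i)) \<or>
     (\<exists>x i y j z k. div_atom A x \<and> div_atom A y \<and> div_atom A z \<and>
        u = Some (x, i) \<and> v = Some (y, j) \<and> w = Some (z, k) \<and>
        ra_le A z (cp A x y) \<and>
        (cE E A x = cE E A y \<and> cE E A y = cE E A z \<longrightarrow> T3 i j k))"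

definition Ctri :: "'a ra \<Rightarrow> 'a ra \<Rightarrow> ('a \<times> nat) option \<Rightarrow> ('a \<times> nat) option
                       \<Rightarrow> ('a \<times> nat) option \<Rightarrow> bool" where
  "Ctri E A u v w \<longleftrightarrow>
     Cbase E A u v w \<or> Cbase E A u w v \<or> Cbase E A v u w \<or>
     Cbase E A v w u \<or> Cbase E A w u v \<or> Cbase E A w v u"

definition CEA :: "'a ra \<Rightarrow> 'a ra \<Rightarrow> ('a \<times> nat) option set ra" where
  "CEA E A = \<lparr> car = Pow (CAt A),
               jn = (\<lambda>X Y. X \<union> Y),
               cm = (\<lambda>X. CAt A - X),
               cp = (\<lambda>X Y. {w. \<exists>u\<in>X. \<exists>v\<in>Y. Ctri E A u v w}),
               cv = (\<lambda>X. X),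
               idt = {None} \<rparr>"

definition BEA :: "'a ra \<Rightarrow> 'a ra \<Rightarrow> ('a \<times> nat) option set ra" where
  "BEA E A = restrict_ra (CEA E A) (gen_univ (CEA E A) {X. ra_atom (CEA E A) X})"

definition in_Bk :: "('a, 'z) ra_scheme \<Rightarrow> nat \<Rightarrow> (nat \<Rightarrow> nat \<Rightarrow> 'a) \<Rightarrow> bool" where
  "in_Bk A k \<mu> \<longleftrightarrow>
     (\<forall>i<k. \<forall>j<k. ra_atom A (\<mu> i j)) \<and>
     (\<forall>i<k. ra_le A (\<mu> i i) (idt A)) \<and>
     (\<forall>i<k. \<forall>j<k. cv A (\<mu> i j) = \<mu> j i) \<and>
     (\<forall>i<k. \<forall>j<k. \<forall>l<k. ra_le A (\<mu> i j) (cp A (\<mu> i l) (\<mu> l j)))"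

definition id_cond :: "('a, 'z) ra_scheme \<Rightarrow> nat \<Rightarrow> (nat \<Rightarrow> nat \<Rightarrow> 'a) \<Rightarrow> bool" where
  "id_cond A k \<mu> \<longleftrightarrow> (\<forall>l<k. \<forall>m<k. \<mu> l m = idt A \<longleftrightarrow> l = m)"

definition one_point_ext :: "('a, 'z) ra_scheme \<Rightarrow> bool" where
  "one_point_ext A \<longleftrightarrow>
     (\<forall>k \<mu> x y i j. in_Bk A k \<mu> \<and> id_cond A k \<mu> \<and> div_atom A x \<and> div_atom A y \<and>
        i < k \<and> j < k \<and> i \<noteq> j \<and> ra_le A (\<mu> i j) (cp A x y) \<longrightarrow>
        (\<exists>\<mu>'. in_Bk A (Suc k) \<mu>' \<and> id_cond A (Suc k) \<mu>' \<and>
              (\<forall>l<k. \<forall>m<k. \<mu>' l m = \<mu> l m) \<and> \<mu>' i k = x \<and> \<mu>' k j = y))"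

definition is_representation ::
    "('a, 'z) ra_scheme \<Rightarrow> ('b \<times> 'b) set \<Rightarrow> ('a \<Rightarrow> ('b \<times> 'b) set) \<Rightarrow> bool" where
  "is_representation A U h \<longleftrightarrow>
     equiv (Field U) U \<and> inj_on h (car A) \<and>
     (\<forall>x\<in>car A. h x \<subseteq> U) \<and>
     (\<forall>x\<in>car A. \<forall>y\<in>car A. h (jn A x y) = h x \<union> h y) \<and>
     (\<forall>x\<in>car A. h (cm A x) = U - h x) \<and>
     (\<forall>x\<in>car A. \<forall>y\<in>car A. h (cp A x y) = h x O h y) \<and>
     (\<forall>x\<in>car A. h (cv A x) = (h x)\<inverse>) \<and>
     h (idt A) = Id_on (Field U)"

definition representable_over :: "'b itself \<Rightarrow> ('a, 'z) ra_scheme \<Rightarrow> bool" where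
  "representable_over (_::'b itself) A \<longleftrightarrow>
     (\<exists>(U::('b \<times> 'b) set) h. is_representation A U h)"

definition is_sup :: "('a, 'z) ra_scheme \<Rightarrow> 'a set \<Rightarrow> 'a \<Rightarrow> bool" where
  "is_sup A S s \<longleftrightarrow> s \<in> car A \<and> (\<forall>x\<in>S. ra_le A x s) \<and>
     (\<forall>t\<in>car A. (\<forall>x\<in>S. ra_le A x t) \<longrightarrow> ra_le A s t)"

definition is_complete_representation ::
    "('a, 'z) ra_scheme \<Rightarrow> ('b \<times> 'b) set \<Rightarrow> ('a \<Rightarrow> ('b \<times> 'b) set) \<Rightarrow> bool" where
  "is_complete_representation A U h \<longleftrightarrow> is_representation A U h \<and>
     (\<forall>S s. S \<subseteq> car A \<and> is_sup A S s \<longrightarrow> h s = \<Union>(h ` S))"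

definition completely_representable_over :: "'b itself \<Rightarrow> ('a, 'z) ra_scheme \<Rightarrow> bool" where
  "completely_representable_over (_::'b itself) A \<longleftrightarrow>
     (\<exists>(U::('b \<times> 'b) set) h. is_complete_representation A U h)"

definition complete_ra :: "('a, 'z) ra_scheme \<Rightarrow> bool" where
  "complete_ra A \<longleftrightarrow> (\<forall>S. S \<subseteq> car A \<longrightarrow> (\<exists>s. is_sup A S s))"

definition embedding :: "('a, 'z) ra_scheme \<Rightarrow> ('c, 'w) ra_scheme \<Rightarrow> ('a \<Rightarrow> 'c) \<Rightarrow> bool" where
  "embedding B D f \<longleftrightarrow> inj_on f (car B) \<and> f ` car B \<subseteq> car D \<and>
     (\<forall>x\<in>car B. \<forall>y\<in>car B. f (jn B x y) = jn D (f x) (f y) \<and> f (cp B x y) = cp D (f x) (f y)) \<and>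
     (\<forall>x\<in>car B. f (cm B x) = cm D (f x) \<and> f (cv B x) = cv D (f x)) \<and>
     f (idt B) = idt D"

definition is_completion :: "('a, 'z) ra_scheme \<Rightarrow> ('c, 'w) ra_scheme \<Rightarrow> ('a \<Rightarrow> 'c) \<Rightarrow> bool" where
  "is_completion B D f \<longleftrightarrow> is_ra D \<and> complete_ra D \<and> embedding B D f \<and>
     (\<forall>d\<in>car D. d \<noteq> ra_zero D \<longrightarrow>
        (\<exists>b\<in>car B. f b \<noteq> ra_zero D \<and> ra_le D (f b) d))"

definition no_one_cycles :: "'a ra \<Rightarrow> bool" where
  "no_one_cycles A \<longleftrightarrow>
     (\<forall>u. ra_atom A u \<and> u \<noteq> idt A \<longrightarrow> ra_meet A (cp A u u) u = ra_zero A)"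

end

theory Submission
  imports Defs "HOL-Library.Extended_Nat" "HOL-Library.Countable_Set" "HOL-Library.Ramsey"
begin

text \<open>
  Let \<open>e\<^sup>n\<close> be the set of all \<open>x\<^sup>(\<^sup>k\<^sup>)\<close> with \<open>c(x) = e\<close> and \<open>k \<ge> n\<close>. The sets that contain or avoid
  each \<open>e\<^sup>n\<close> form a finite subalgebra \<open>D\<^sub>n\<close>, and \<open>\<^bold>B\<close> is contained in the union of the \<open>D\<^sub>n\<close>. Given two
  diversity labels, some member \<open>p\<close> of the flexible trio of \<open>\<^bold>E\<close> differs from both their colours and
  has relative product \<open>0'\<close> with both of them; the label containing \<open>p\<^sup>n\<close> can then be used on
  all the other edges to a new point. This gives (i), with \<open>\<^bold>B \<inter> D\<^sub>n\<close> as the subalgebra.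

  For (ii) the same argument is run with the index set \<open>\<omega> + 1\<close> in place of \<open>\<omega>\<close>, the labels being
  the atoms and one limit label for each colour, which represents the ultrafilter generated by the tails
  of that colour. A step-by-step construction yields a saturated labelling of
  \<open>\<omega> \<times> \<omega>\<close>, hence a representation of the union of the \<open>D\<^sub>n\<close>.

  For (iii), every point of a representation has, for each \<open>i\<close>, an \<open>x\<^sup>(\<^sup>i\<^sup>)\<close>-successor, so the base
  is infinite. A complete representation of \<open>\<^bold>B\<close>, or any representation of its completion, colours the
  pairs of distinct points with the finitely many diversity atoms of \<open>\<^bold>A\<close>, and without 1-cycles no
  triangle is monochromatic. This contradicts Ramsey's theorem.
\<close>

section \<open>Atoms of relation algebras\<close>

locale rel_alg =
  fixes A :: "'a ra"
  assumes ra: "is_ra A"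
begin

abbreviation join (infixl \<open>\<oplus>\<close> 65) where "x \<oplus> y \<equiv> jn A x y"
abbreviation compl (\<open>\<ominus>_\<close> [80] 80) where "\<ominus>x \<equiv> cm A x"
abbreviation le (infix \<open>\<sqsubseteq>\<close> 50) where "x \<sqsubseteq> y \<equiv> ra_le A x y"
abbreviation "zero \<equiv> ra_zero A"
abbreviation "\<C> \<equiv> car A"
definition one where "one = idt A \<oplus> \<ominus>idt A"

lemma clos [simp]:
  "idt A \<in> \<C>" "x \<in> \<C> \<Longrightarrow> \<ominus>x \<in> \<C>" "x \<in> \<C> \<Longrightarrow> cv A x \<in> \<C>"
  "x \<in> \<C> \<Longrightarrow> y \<in> \<C> \<Longrightarrow> x \<oplus> y \<in> \<C>"
  "x \<in> \<C> \<Longrightarrow> y \<in> \<C> \<Longrightarrow> cp A x y \<in> \<C>"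
  using ra by (auto simp: is_ra_def)

section \<open>Boolean algebra from Huntington's equation\<close>

lemma axioms:
  "\<forall>x\<in>\<C>. \<forall>y\<in>\<C>. x \<oplus> y = y \<oplus> x"
  "\<forall>x\<in>\<C>. \<forall>y\<in>\<C>. \<forall>z\<in>\<C>. x \<oplus> (y \<oplus> z) = (x \<oplus> y) \<oplus> z"
  "\<forall>x\<in>\<C>. \<forall>y\<in>\<C>. \<ominus>(\<ominus>x \<oplus> y) \<oplus> \<ominus>(\<ominus>x \<oplus> \<ominus>y) = x"
  "\<forall>x\<in>\<C>. \<forall>y\<in>\<C>. \<forall>z\<in>\<C>. cp A (x \<oplus> y) z = cp A x z \<oplus> cp A y z"
  "\<forall>x\<in>\<C>. \<forall>y\<in>\<C>. cv A (cp A x y) = cp A (cv A y) (cv A x)"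
  "\<forall>x\<in>\<C>. \<forall>y\<in>\<C>. cp A (cv A x) (\<ominus>(cp A x y)) \<oplus> \<ominus>y = \<ominus>y"
  using ra unfolding is_ra_def by - (elim conjE, assumption)+

lemmas comm = axioms(1)[rule_format]
  and assoc = axioms(2)[rule_format, symmetric]
  and huntington = axioms(3)[rule_format]
  and cp_join1 = axioms(4)[rule_format]
  and cv_cp = axioms(5)[rule_format]
  and tarski = axioms(6)[folded ra_le_def, rule_format]

lemma lcomm: "x \<in> \<C> \<Longrightarrow> y \<in> \<C> \<Longrightarrow> z \<in> \<C> \<Longrightarrow> x \<oplus> (y \<oplus> z) = y \<oplus> (x \<oplus> z)"
  by (metis assoc comm)

lemmas ac = assoc comm lcomm

text \<open>Huntington's equation splits x, y and their complements into the four cells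
  \<open>p\<close>, \<open>q\<close>, \<open>r\<close>, \<open>s\<close>; both sides are the join of
  all four.\<close>

lemma excluded_middle:
  assumes "x \<in> \<C>" "y \<in> \<C>"
  shows "x \<oplus> \<ominus>x = y \<oplus> \<ominus>y"
proof -
  define p where "p = \<ominus>(\<ominus>x \<oplus> \<ominus>y)"
  define q where "q = \<ominus>(\<ominus>x \<oplus> \<ominus>\<ominus>y)"
  define r where "r = \<ominus>(\<ominus>\<ominus>x \<oplus> \<ominus>y)"
  define s where "s = \<ominus>(\<ominus>\<ominus>x \<oplus> \<ominus>\<ominus>y)"
  have c: "p \<in> \<C>" "q \<in> \<C>" "r \<in> \<C>" "s \<in> \<C>"
    using assms by (simp_all add: p_def q_def r_def s_def)
  have x: "p \<oplus> q = x" "r \<oplus> s = \<ominus>x"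
    using assms by (simp_all add: p_def q_def r_def s_def huntington)
  have y: "p \<oplus> r = y" "q \<oplus> s = \<ominus>y"
    using assms huntington[of y "\<ominus>x"] huntington[of "\<ominus>y" "\<ominus>x"]
    by (simp_all add: p_def q_def r_def s_def comm[of "\<ominus>y"] comm[of "\<ominus>\<ominus>y"])
  have "(p \<oplus> q) \<oplus> (r \<oplus> s) = (p \<oplus> r) \<oplus> (q \<oplus> s)"
    using c by (simp add: ac)
  then show ?thesis by (simp only: x y)
qed

text \<open>Huntington's equation writes both sides as joins of two complements, which agree up to
  commutativity and \<open>excluded_middle\<close>.\<close>

lemma compl_compl [simp]:
  assumes "x \<in> \<C>"
  shows "\<ominus>\<ominus>x = x"
proof -
  have "\<ominus>\<ominus>x = \<ominus>(\<ominus>\<ominus>\<ominus>x \<oplus> \<ominus>x) \<oplus> \<ominus>(\<ominus>\<ominus>\<ominus>x \<oplus> \<ominus>\<ominus>x)"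
    using assms huntington by simp
  moreover have "x = \<ominus>(\<ominus>x \<oplus> \<ominus>\<ominus>x) \<oplus> \<ominus>(\<ominus>x \<oplus> \<ominus>\<ominus>\<ominus>x)"
    using assms huntington by simp
  moreover have "\<ominus>\<ominus>\<ominus>x \<oplus> \<ominus>\<ominus>x = \<ominus>x \<oplus> \<ominus>\<ominus>x"
    using assms excluded_middle[of "\<ominus>\<ominus>x" "\<ominus>x"] by (simp add: comm)
  ultimately show ?thesis using assms by (simp add: comm)
qed

lemma join_compl: "x \<in> \<C> \<Longrightarrow> x \<oplus> \<ominus>x = one"
  unfolding one_def by (rule excluded_middle) simp_all

lemma zero_eq: "zero = \<ominus>one"
  by (simp add: ra_zero_def ra_meet_def one_def comm[of "\<ominus>idt A" "idt A"])

lemma one_clos [simp]: "one \<in> \<C>" and zero_clos [simp]: "zero \<in> \<C>"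
  by (simp_all add: one_def zero_eq)

lemma compl_zero [simp]: "\<ominus>zero = one" and compl_one [simp]: "\<ominus>one = zero"
  by (simp_all add: zero_eq)

text \<open>Idempotence is needed for the unit first: it gives 0 + 0 = 0, from which
  \<open>join_zero\<close> and \<open>join_idem\<close> follow.\<close>

lemma one_join_one: "one \<oplus> one = one"
proof -
  let ?t = "one \<oplus> one"
  have z: "zero = \<ominus>?t \<oplus> zero"
    using huntington[of zero one] join_compl[of one] comm[of "\<ominus>?t" zero] by simp
  have "one = one \<oplus> zero"
    using join_compl[of one] by simp
  also have "\<dots> = one \<oplus> (\<ominus>?t \<oplus> zero)"
    using z by simp
  also have "\<dots> = \<ominus>?t \<oplus> (one \<oplus> zero)"
    by (simp add: lcomm)
  also have "\<dots> = \<ominus>?t \<oplus> one"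
    using join_compl[of one] by simp
  finally have "one \<oplus> one = one \<oplus> (\<ominus>?t \<oplus> one)"
    by simp
  also have "\<dots> = ?t \<oplus> \<ominus>?t"
    by (simp add: ac)
  also have "\<dots> = one"
    by (rule join_compl) simp
  finally show ?thesis .
qed

lemma join_zero [simp]: "x \<in> \<C> \<Longrightarrow> x \<oplus> zero = x"
  and join_idem [simp]: "x \<in> \<C> \<Longrightarrow> x \<oplus> x = x"
proof -
  have z: "zero \<oplus> zero = zero"
    using huntington[of zero one] join_compl[of one] one_join_one by simp
  \<comment> \<open>Huntington's equation exhibits every y as something joined with zero; as zero +
    zero = zero, joining zero once more changes nothing.\<close>
  have H: "\<ominus>(\<ominus>y \<oplus> \<ominus>y) \<oplus> zero = y" if "y \<in> \<C>" for y
    using huntington[of y "\<ominus>y"] join_compl[of "\<ominus>y"] that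
      comm[of zero "\<ominus>(\<ominus>y \<oplus> \<ominus>y)"] by simp
  have Z: "y \<oplus> zero = y" if "y \<in> \<C>" for y
  proof -
    have "y \<oplus> zero = (\<ominus>(\<ominus>y \<oplus> \<ominus>y) \<oplus> zero) \<oplus> zero" by (simp only: H[OF that])
    also have "\<dots> = \<ominus>(\<ominus>y \<oplus> \<ominus>y) \<oplus> zero" using z that by (simp add: assoc)
    finally show ?thesis by (simp only: H[OF that])
  qed
  show "x \<in> \<C> \<Longrightarrow> x \<oplus> zero = x" using Z .
  show "x \<oplus> x = x" if x: "x \<in> \<C>"
  proof -
    have "\<ominus>(x \<oplus> x) = \<ominus>x" using H[of "\<ominus>x"] Z[of "\<ominus>(x \<oplus> x)"] x by simp
    then have "\<ominus>\<ominus>(x \<oplus> x) = \<ominus>\<ominus>x" by simp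
    then show ?thesis using x by simp
  qed
qed

lemma le_refl [simp]: "x \<in> \<C> \<Longrightarrow> x \<sqsubseteq> x"
  by (simp add: ra_le_def)

lemma le_antisym: "x \<sqsubseteq> y \<Longrightarrow> y \<sqsubseteq> x \<Longrightarrow> x \<in> \<C> \<Longrightarrow> y \<in> \<C> \<Longrightarrow> x = y"
  by (metis ra_le_def comm)

lemma le_trans: "x \<sqsubseteq> y \<Longrightarrow> y \<sqsubseteq> z \<Longrightarrow> x \<in> \<C> \<Longrightarrow> y \<in> \<C> \<Longrightarrow> z \<in> \<C> \<Longrightarrow> x \<sqsubseteq> z"
  by (metis ra_le_def assoc)

lemma le_join1: "x \<in> \<C> \<Longrightarrow> y \<in> \<C> \<Longrightarrow> x \<sqsubseteq> x \<oplus> y"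
  by (metis ra_le_def assoc join_idem)

lemma zero_le [simp]: "x \<in> \<C> \<Longrightarrow> zero \<sqsubseteq> x"
  by (simp add: ra_le_def comm)

abbreviation meet (infixl \<open>\<odot>\<close> 70) where "x \<odot> y \<equiv> ra_meet A x y"

lemma meet_clos [simp]: "x \<in> \<C> \<Longrightarrow> y \<in> \<C> \<Longrightarrow> x \<odot> y \<in> \<C>"
  by (simp add: ra_meet_def)

lemma meet_comm: "x \<in> \<C> \<Longrightarrow> y \<in> \<C> \<Longrightarrow> x \<odot> y = y \<odot> x"
  by (simp add: ra_meet_def comm)

lemma split: "x \<in> \<C> \<Longrightarrow> y \<in> \<C> \<Longrightarrow> x \<odot> y \<oplus> x \<odot> \<ominus>y = x"
  using huntington[of x y] by (simp add: ra_meet_def comm)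

lemma meet_le1: "x \<in> \<C> \<Longrightarrow> y \<in> \<C> \<Longrightarrow> x \<odot> y \<sqsubseteq> x"
  using le_join1[of "x \<odot> y" "x \<odot> \<ominus>y"] by (simp add: split)

lemma meet_le2: "x \<in> \<C> \<Longrightarrow> y \<in> \<C> \<Longrightarrow> x \<odot> y \<sqsubseteq> y"
  using meet_le1 meet_comm by metis

lemma le_iff_compl: assumes "x \<in> \<C>" "y \<in> \<C>" shows "\<ominus>y \<sqsubseteq> \<ominus>x \<longleftrightarrow> x \<sqsubseteq> y"
proof -
  have "\<ominus>y \<sqsubseteq> \<ominus>x" if "x \<sqsubseteq> y" "x \<in> \<C>" "y \<in> \<C>" for x y
  proof -
    have "\<ominus>x \<odot> \<ominus>y = \<ominus>y" using that by (simp add: ra_meet_def ra_le_def)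
    then show ?thesis using that meet_le1[of "\<ominus>x" "\<ominus>y"] by simp
  qed
  from this[of x y] this[of "\<ominus>y" "\<ominus>x"] show ?thesis using assms by auto
qed

lemma le_meetI:
  assumes "z \<sqsubseteq> x" "z \<sqsubseteq> y" "x \<in> \<C>" "y \<in> \<C>" "z \<in> \<C>"
  shows "z \<sqsubseteq> x \<odot> y"
proof -
  have "\<ominus>x \<sqsubseteq> \<ominus>z" "\<ominus>y \<sqsubseteq> \<ominus>z" using assms by (simp_all add: le_iff_compl)
  then have "\<ominus>x \<oplus> \<ominus>y \<sqsubseteq> \<ominus>z" using assms by (simp add: ra_le_def assoc)
  then have "\<ominus>\<ominus>z \<sqsubseteq> \<ominus>(\<ominus>x \<oplus> \<ominus>y)" using assms le_iff_compl[of "\<ominus>x \<oplus> \<ominus>y" "\<ominus>z"] by simp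
  then show ?thesis using assms by (simp add: ra_meet_def)
qed

lemma meet_compl: "x \<in> \<C> \<Longrightarrow> x \<odot> \<ominus>x = zero"
  by (simp add: ra_meet_def comm[of "\<ominus>x" x] join_compl)

lemma le_if_meet_zero: "x \<in> \<C> \<Longrightarrow> y \<in> \<C> \<Longrightarrow> x \<odot> \<ominus>y = zero \<Longrightarrow> x \<sqsubseteq> y"
  by (metis clos(2) join_zero meet_clos meet_le2 split)

lemma le_zeroD: "x \<sqsubseteq> zero \<Longrightarrow> x \<in> \<C> \<Longrightarrow> x = zero"
  by (simp add: ra_le_def)

lemma atom_clos [intro]: "ra_atom A t \<Longrightarrow> t \<in> \<C>" "div_atom A t \<Longrightarrow> t \<in> \<C>"
  by (auto simp: ra_atom_def div_atom_def)

lemma atom_le_compl: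
  assumes "ra_atom A t" "x \<in> \<C>"
  shows "t \<sqsubseteq> \<ominus>x \<longleftrightarrow> \<not> t \<sqsubseteq> x"
proof
  have t: "t \<in> \<C>" "t \<noteq> zero" using assms by (auto simp: ra_atom_def)
  show "\<not> t \<sqsubseteq> x" if "t \<sqsubseteq> \<ominus>x"
  proof
    assume "t \<sqsubseteq> x"
    then have "t \<sqsubseteq> x \<odot> \<ominus>x" using that assms t by (simp add: le_meetI)
    then show False using t assms by (simp add: meet_compl le_zeroD)
  qed
  show "t \<sqsubseteq> \<ominus>x" if "\<not> t \<sqsubseteq> x"
  proof -
    have "t \<odot> x \<noteq> t" using that meet_le2[of t x] t assms by auto
    then have "t \<odot> x = zero" using assms meet_le1[of t x] t by (auto simp: ra_atom_def)
    then show ?thesis using le_if_meet_zero[of t "\<ominus>x"] t assms by simp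
  qed
qed

lemma ex_atom:
  assumes "finite \<C>" "x \<in> \<C>" "x \<noteq> zero"
  shows "\<exists>t. ra_atom A t \<and> t \<sqsubseteq> x"
  using assms(2,3)
proof (induct "card {y \<in> \<C>. y \<sqsubseteq> x}" arbitrary: x rule: less_induct)
  case less
  show ?case
  proof (cases "ra_atom A x")
    case True
    then show ?thesis using less.prems le_refl by blast
  next
    case False
    then obtain y where y: "y \<in> \<C>" "y \<sqsubseteq> x" "y \<noteq> zero" "y \<noteq> x"
      using less.prems by (auto simp: ra_atom_def)
    have "{z \<in> \<C>. z \<sqsubseteq> y} \<subseteq> {z \<in> \<C>. z \<sqsubseteq> x}"
    proof safe
      show "z \<sqsubseteq> x" if "z \<in> \<C>" "z \<sqsubseteq> y" for z
        using le_trans[OF that(2) y(2) that(1) y(1) less.prems(1)] .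
    qed
    moreover have "x \<notin> {z \<in> \<C>. z \<sqsubseteq> y}" using le_antisym[OF _ y(2) less.prems(1) y(1)] y(4) by auto
    moreover have "x \<in> {z \<in> \<C>. z \<sqsubseteq> x}" using less.prems by simp
    ultimately have "{z \<in> \<C>. z \<sqsubseteq> y} \<subset> {z \<in> \<C>. z \<sqsubseteq> x}"
      by blast
    then have lt: "card {z \<in> \<C>. z \<sqsubseteq> y} < card {z \<in> \<C>. z \<sqsubseteq> x}"
      using assms(1) by (simp add: psubset_card_mono)
    obtain t where "ra_atom A t" "t \<sqsubseteq> y"
      using less.hyps[OF lt y(1,3)] by (elim exE conjE)
    then show ?thesis
      using le_trans[OF _ y(2) _ y(1) less.prems(1)] by (auto simp: ra_atom_def)
  qed
qed

lemma cp_mono1: "x \<sqsubseteq> y \<Longrightarrow> x \<in> \<C> \<Longrightarrow> y \<in> \<C> \<Longrightarrow> z \<in> \<C> \<Longrightarrow> cp A x z \<sqsubseteq> cp A y z"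
  by (metis ra_le_def cp_join1)

end

section \<open>Symmetric relation algebras\<close>

locale sym_rel_alg = rel_alg +
  assumes sym: "symmetric A"
begin

lemma cv_id [simp]: "x \<in> \<C> \<Longrightarrow> cv A x = x"
  using sym by (simp add: symmetric_def)

lemma cp_comm: "x \<in> \<C> \<Longrightarrow> y \<in> \<C> \<Longrightarrow> cp A x y = cp A y x"
  by (metis cv_cp cv_id clos(5))

lemma cp_mono:
  "x \<sqsubseteq> x' \<Longrightarrow> y \<sqsubseteq> y' \<Longrightarrow> x \<in> \<C> \<Longrightarrow> y \<in> \<C> \<Longrightarrow> x' \<in> \<C> \<Longrightarrow> y' \<in> \<C> \<Longrightarrow> cp A x y \<sqsubseteq> cp A x' y'"
  using le_trans[of "cp A x y" "cp A x' y" "cp A x' y'"]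
    cp_mono1[of x x' y] cp_mono1[of y y' x'] cp_comm[of x' y] cp_comm[of x' y'] by simp

text \<open>With converse the identity, Tarski's axiom reads x;-(x;y) <= -y. If z were not below
  x;y, the atom z would lie below -(x;y), hence y <= x;z <= -y.\<close>

lemma peirce:
  assumes "ra_atom A y" "ra_atom A z" "x \<in> \<C>" "y \<sqsubseteq> cp A x z"
  shows "z \<sqsubseteq> cp A x y"
proof (rule ccontr)
  have c: "y \<in> \<C>" "z \<in> \<C>" using assms by auto
  assume "\<not> z \<sqsubseteq> cp A x y"
  then have "z \<sqsubseteq> \<ominus>(cp A x y)" using assms c by (simp add: atom_le_compl)
  then have "cp A x z \<sqsubseteq> cp A x (\<ominus>(cp A x y))" using assms c by (simp add: cp_mono)
  moreover have "cp A x (\<ominus>(cp A x y)) \<sqsubseteq> \<ominus>y"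
    using tarski[of x y] assms(3) c by simp
  ultimately have "cp A x z \<sqsubseteq> \<ominus>y" using assms c
      le_trans[of "cp A x z" "cp A x (\<ominus>(cp A x y))" "\<ominus>y"] by simp
  then have "y \<sqsubseteq> \<ominus>y" using assms c le_trans[of y "cp A x z" "\<ominus>y"] by simp
  then show False using assms(1) c by (simp add: atom_le_compl)
qed

end

section \<open>Networks with flexible labels\<close>

text \<open>\<open>T(i,j,k)\<close> over an arbitrary linear order: the maximum of \<open>i, j, k\<close> is attained at least
  twice. Besides \<open>\<omega>\<close> it is needed for \<open>\<omega> + 1\<close>, rendered as \<^typ>\<open>enat\<close>.\<close>

definition ultra :: "'i::linorder \<Rightarrow> 'i \<Rightarrow> 'i \<Rightarrow> bool" where
  "ultra i j k \<longleftrightarrow> (i \<le> j \<and> j = k) \<or> (j \<le> k \<and> k = i) \<or> (k \<le> i \<and> i = j)"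

lemma ultra_mono: "mono f \<Longrightarrow> ultra i j k \<Longrightarrow> ultra (f i) (f j) (f k)"
  by (auto simp: ultra_def dest: monoD)

lemma ultra_swap: "ultra i j k \<longleftrightarrow> ultra j i k" "ultra i j k \<longleftrightarrow> ultra i k j"
  by (auto simp: ultra_def)

text \<open>Everything the combinatorial part needs to know about \<open>\<^bold>E \<subseteq> \<^bold>A\<close>: \<open>K\<close> are the diversity atoms
  of \<open>\<^bold>A\<close>, \<open>col\<close> is the paper's \<open>c\<close>, and \<open>R x y z\<close> is \<open>x;y \<ge> z\<close>. The assumptions \<open>R_col\<close> and
  \<open>R_col_eq\<close> encode the special extension, \<open>flexible\<close> the flexible trio: each atom excludes at
  most one member of the trio, so two atoms leave a common one.\<close>

locale split_structure =
  fixes K :: "'a set" and col :: "'a \<Rightarrow> 'e" and R :: "'a \<Rightarrow> 'a \<Rightarrow> 'a \<Rightarrow> bool"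
  assumes finite_K: "finite K"
    and R_swap12: "\<lbrakk>x \<in> K; y \<in> K; z \<in> K; R x y z\<rbrakk> \<Longrightarrow> R y x z"
    and R_swap23: "\<lbrakk>x \<in> K; y \<in> K; z \<in> K; R x y z\<rbrakk> \<Longrightarrow> R x z y"
    and R_col: "\<lbrakk>x \<in> K; y \<in> K; z \<in> K; R x y z; \<not> (col x = col y \<and> col y = col z);
        x' \<in> K; y' \<in> K; z' \<in> K; col x' = col x; col y' = col y; col z' = col z\<rbrakk> \<Longrightarrow> R x' y' z'"
    and R_col_eq: "\<lbrakk>x \<in> K; y \<in> K; z \<in> K; R x y z; col x = col y; col y = col z;
        x' \<in> K; y' \<in> K; col x' = col x; col y' = col x\<rbrakk> \<Longrightarrow> \<exists>z'\<in>K. col z' = col x \<and> R x' y' z'"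
    and flexible: "\<lbrakk>x \<in> K; y \<in> K\<rbrakk> \<Longrightarrow> \<exists>p\<in>K. col p \<noteq> col x \<and> col p \<noteq> col y \<and>
        (\<forall>z\<in>K. R x p z \<and> R y p z \<and> (\<exists>u\<in>K. \<exists>v\<in>K. col u = col p \<and> col v = col p \<and> R u v z))"
begin

text \<open>Polymorphic in the index type: with \<open>nat\<close> these are the atoms of C_E(A),
  while \<open>enat\<close> adds the points at infinity.\<close>

definition pts :: "('a \<times> 'i) option set" where
  "pts = insert None (Some ` (K \<times> UNIV))"

lemma None_pts [simp]: "None \<in> pts" and Some_pts [simp]: "Some (x, i) \<in> pts \<longleftrightarrow> x \<in> K"
  by (auto simp: pts_def)

text \<open>A case analysis replaces the permutations in \<open>Ctri\<close>; symmetry comes from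
  \<open>R_swap12\<close>, \<open>R_swap23\<close> and \<open>ultra_swap\<close>.\<close>

definition tri :: "('a \<times> 'i::linorder) option \<Rightarrow> ('a \<times> 'i) option \<Rightarrow> ('a \<times> 'i) option \<Rightarrow> bool" where
  "tri u v w \<longleftrightarrow> (case u of None \<Rightarrow> v = w \<and> v \<in> pts | Some (x, i) \<Rightarrow>
     (case v of None \<Rightarrow> u = w \<and> x \<in> K | Some (y, j) \<Rightarrow>
     (case w of None \<Rightarrow> u = v \<and> x \<in> K | Some (z, k) \<Rightarrow>
        x \<in> K \<and> y \<in> K \<and> z \<in> K \<and> R x y z \<and> (col x = col y \<and> col y = col z \<longrightarrow> ultra i j k))))"

lemma tri_simps [simp]:
  "tri None v w \<longleftrightarrow> v = w \<and> v \<in> pts"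
  "tri u None w \<longleftrightarrow> u = w \<and> u \<in> pts"
  "tri u v None \<longleftrightarrow> u = v \<and> u \<in> pts"
  "tri (Some (x, i)) (Some (y, j)) (Some (z, k)) \<longleftrightarrow>
     x \<in> K \<and> y \<in> K \<and> z \<in> K \<and> R x y z \<and> (col x = col y \<and> col y = col z \<longrightarrow> ultra i j k)"
  by (auto simp: tri_def split: option.splits)

lemma tri_pts: "tri u v w \<Longrightarrow> u \<in> pts \<and> v \<in> pts \<and> w \<in> pts"
  by (cases u; cases v; cases w) (auto simp: tri_def)

lemma tri_swap12: assumes "tri u v w" shows "tri v u w"
  using assms by (cases u; cases v; cases w) (auto intro: R_swap12 simp: ultra_swap(1))

lemma tri_swap23: assumes "tri u v w" shows "tri u w v"
  using assms by (cases u; cases v; cases w) (auto intro: R_swap23 simp: ultra_swap(2))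

lemma tri_map:
  assumes "mono f" "tri u v w"
  shows "tri (map_option (map_prod id f) u) (map_option (map_prod id f) v)
           (map_option (map_prod id f) w)"
  using assms(2) ultra_mono[OF assms(1)]
  by (cases u; cases v; cases w) auto

text \<open>Labels are consistent as soon as one triple of their points is. For atoms of a
  subalgebra this is Z <= X;Y, since an atom that meets X;Y lies below it.\<close>

definition Tri :: "('a \<times> 'i::linorder) option set \<Rightarrow> _ \<Rightarrow> _ \<Rightarrow> bool" where
  "Tri X Y Z \<longleftrightarrow> (\<exists>u\<in>X. \<exists>v\<in>Y. \<exists>w\<in>Z. tri u v w)"

lemma Tri_swap12: "Tri X Y Z \<Longrightarrow> Tri Y X Z"
  unfolding Tri_def by (meson tri_swap12)

lemma Tri_swap23: "Tri X Y Z \<Longrightarrow> Tri X Z Y"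
  unfolding Tri_def by (meson tri_swap23)

lemma Tri_None: "X \<noteq> {} \<Longrightarrow> X \<subseteq> pts \<Longrightarrow> Tri X X {None}"
  unfolding Tri_def by fastforce

definition comp :: "('a \<times> 'i::linorder) option set \<Rightarrow> _ \<Rightarrow> _" where
  "comp X Y = {w. \<exists>u\<in>X. \<exists>v\<in>Y. tri u v w}"

text \<open>This is e^n for the colour e = \<open>col p\<close>.\<close>

definition tail :: "'a \<Rightarrow> 'i::linorder \<Rightarrow> ('a \<times> 'i) option set" where
  "tail p n = {Some (v, j) | v j. v \<in> K \<and> col v = col p \<and> n \<le> j}"

text \<open>Take p flexible for one point of X and one of Y. Its colour differs from theirs, so no
  index condition arises in the first two triangles. Since p depends on X and Y only, one label Q
  can serve all other edges to a new point.\<close>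

lemma ex_flexible_label:
  fixes X Y :: "('a \<times> 'i::linorder) option set"
  assumes "X \<noteq> {}" "X \<subseteq> pts" "None \<notin> X" "Y \<noteq> {}" "Y \<subseteq> pts" "None \<notin> Y"
  shows "\<exists>p\<in>K. \<forall>(n::'i) Q Z. tail p n \<subseteq> Q \<and> Z \<noteq> {} \<and> Z \<subseteq> pts \<and> None \<notin> Z \<longrightarrow>
           Tri X Q Z \<and> Tri Y Q Z \<and> Tri Q Q Z"
proof -
  have E: "\<exists>x i. Some (x, i) \<in> X \<and> x \<in> K" if X: "X \<noteq> {}" "X \<subseteq> pts" "None \<notin> X"
    for X :: "('a \<times> 'i) option set"
  proof -
    obtain u where u: "u \<in> X" using X by blast
    moreover have "u \<in> pts" using u X(2) by blast
    moreover have "u \<noteq> None" using u X(3) by metis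
    ultimately show ?thesis by (cases u) auto
  qed
  from E[OF assms(1-3)] obtain x i where x: "Some (x, i) \<in> X" "x \<in> K" by blast
  from E[OF assms(4-6)] obtain y j where y: "Some (y, j) \<in> Y" "y \<in> K" by blast
  obtain p where p: "p \<in> K" "col p \<noteq> col x" "col p \<noteq> col y"
    and flex: "\<And>z. z \<in> K \<Longrightarrow> R x p z \<and> R y p z \<and>
        (\<exists>u\<in>K. \<exists>v\<in>K. col u = col p \<and> col v = col p \<and> R u v z)"
    using flexible[OF x(2) y(2)] by blast
  have "Tri X Q Z \<and> Tri Y Q Z \<and> Tri Q Q Z"
    if Q: "tail p n \<subseteq> Q" and Z: "Z \<noteq> {}" "Z \<subseteq> pts" "None \<notin> Z" for n :: 'i and Q Z
  proof -
    from E[OF Z] obtain z k where z: "Some (z, k) \<in> Z" "z \<in> K" by blast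
    obtain u v where uv: "u \<in> K" "v \<in> K" "col u = col p" "col v = col p" "R u v z"
      using flex[OF z(2)] by blast
    have in_Q: "Some (v, m) \<in> Q" if "v \<in> K" "col v = col p" "n \<le> m" for v m
      using Q that by (auto simp: tail_def)
    have "tri (Some (x, i)) (Some (p, n)) (Some (z, k))"
      "tri (Some (y, j)) (Some (p, n)) (Some (z, k))"
      using p x y z flex[OF z(2)] by simp_all
    \<comment> \<open>The index \<open>max n k\<close> is at least n, so both points lie in Q, and
      at least k, so the maximum is attained twice.\<close>
    moreover have "tri (Some (u, max n k)) (Some (v, max n k)) (Some (z, k))"
      using uv z by (simp add: ultra_def)
    moreover have "Some (p, n) \<in> Q" "Some (u, max n k) \<in> Q" "Some (v, max n k) \<in> Q"
      using in_Q p uv by simp_all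
    ultimately show ?thesis using x y z unfolding Tri_def by blast
  qed
  then show ?thesis using p(1) by blast
qed

text \<open>The labels of a network are sets of points: the atoms of a finite subalgebra of \<open>\<^bold>B\<close>, or
  ultrafilters. The last clause provides the flexible labels.\<close>

definition labelling :: "('a \<times> 'i::linorder) option set set \<Rightarrow> bool" where
  "labelling L \<longleftrightarrow> (\<forall>X\<in>L. X \<noteq> {} \<and> X \<subseteq> pts) \<and>
     (\<forall>X\<in>L. \<forall>Y\<in>L. \<forall>u. u \<in> X \<longrightarrow> u \<in> Y \<longrightarrow> X = Y) \<and>
     (\<forall>u\<in>pts. \<exists>X\<in>L. u \<in> X) \<and> {None} \<in> L \<and>
     (\<exists>n. \<forall>p\<in>K. \<exists>Q\<in>L. tail p n \<subseteq> Q)"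

lemma labellingD:
  assumes "labelling L"
  shows "X \<in> L \<Longrightarrow> X \<noteq> {}" "X \<in> L \<Longrightarrow> X \<subseteq> pts" "{None} \<in> L"
    "X \<in> L \<Longrightarrow> Y \<in> L \<Longrightarrow> u \<in> X \<Longrightarrow> u \<in> Y \<Longrightarrow> X = Y"
    "u \<in> pts \<Longrightarrow> \<exists>X\<in>L. u \<in> X"
    "X \<in> L \<Longrightarrow> X \<noteq> {None} \<Longrightarrow> None \<notin> X"
proof -
  show 1: "X \<in> L \<Longrightarrow> X \<noteq> {}" and "X \<in> L \<Longrightarrow> X \<subseteq> pts" and 2: "{None} \<in> L"
    and "u \<in> pts \<Longrightarrow> \<exists>X\<in>L. u \<in> X"
    using assms by (simp_all add: labelling_def)
  show 3: "X \<in> L \<Longrightarrow> Y \<in> L \<Longrightarrow> u \<in> X \<Longrightarrow> u \<in> Y \<Longrightarrow> X = Y" for X Y u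
    using assms unfolding labelling_def by metis
  show "X \<in> L \<Longrightarrow> X \<noteq> {None} \<Longrightarrow> None \<notin> X"
    using 3[OF _ 2, of X None] by fastforce
qed

lemma Tri_None_iff:
  assumes "labelling L" "X \<in> L" "Y \<in> L"
  shows "Tri X Y {None} \<longleftrightarrow> X = Y"
proof
  show "X = Y" if "Tri X Y {None}"
    using that labellingD(4)[OF assms] by (auto simp: Tri_def)
  show "Tri X Y {None}" if "X = Y"
    using that Tri_None[OF labellingD(1,2)[OF assms(1,2)]] by simp
qed

section \<open>Networks and the addition of a point\<close>

definition net :: "('a \<times> 'i::linorder) option set set \<Rightarrow> nat \<Rightarrow> (nat \<Rightarrow> nat \<Rightarrow> _) \<Rightarrow> bool" where
  "net L k N \<longleftrightarrow>
     (\<forall>i<k. \<forall>j<k. N i j \<in> L \<and> (N i j = {None} \<longleftrightarrow> i = j) \<and> N i j = N j i) \<and>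
     (\<forall>i<k. \<forall>j<k. \<forall>l<k. Tri (N i l) (N l j) (N i j))"

text \<open>The new point is joined to i by X, to j by Y and to all other points by the flexible
  label Q. A nondegenerate triangle through it either has an edge labelled Q or is the given one on
  i and j. The case i = j is allowed, as the saturation argument needs it.\<close>

lemma net_extend:
  fixes L :: "('a \<times> 'i::linorder) option set set"
  assumes L: "labelling L" and N: "net L k N" and ij: "i < k" "j < k"
    and X: "X \<in> L" "X \<noteq> {None}" and Y: "Y \<in> L" "Y \<noteq> {None}" and T: "Tri X Y (N i j)"
  shows "\<exists>N'. net L (Suc k) N' \<and> (\<forall>l<k. \<forall>m<k. N' l m = N l m) \<and> N' i k = X \<and> N' k j = Y"
proof -
  note LD = labellingD[OF L]
  have lab: "Z \<noteq> {} \<and> Z \<subseteq> pts \<and> None \<notin> Z" if "Z \<in> L" "Z \<noteq> {None}" for Z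
    using LD(1,2,6) that by blast
  obtain n :: 'i where n: "\<And>p. p \<in> K \<Longrightarrow> \<exists>Q\<in>L. tail p n \<subseteq> Q"
    using L unfolding labelling_def by blast
  obtain p where p: "p \<in> K" and flex: "\<And>Q Z. tail p n \<subseteq> Q \<Longrightarrow> Z \<in> L \<Longrightarrow> Z \<noteq> {None} \<Longrightarrow>
      Tri X Q Z \<and> Tri Y Q Z \<and> Tri Q Q Z"
    using ex_flexible_label[of X Y] lab[OF X] lab[OF Y] lab by meson
  obtain Q where Q: "Q \<in> L" "tail p n \<subseteq> Q" using n p by blast
  have Q0: "Q \<noteq> {None}" using Q(2) p by (auto simp: tail_def)
  have N1: "N l m \<in> L" "N l m = {None} \<longleftrightarrow> l = m" "N l m = N m l" if "l < k" "m < k" for l m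
    using N that unfolding net_def by blast+
  have N2: "Tri (N l r) (N r m) (N l m)" if "l < k" "m < k" "r < k" for l m r
    using N that unfolding net_def by blast
  define row where "row l = (if l = i then X else if l = j then Y else Q)" for l
  have row: "row l \<in> L" "row l \<noteq> {None}" for l
    using X Y Q Q0 by (auto simp: row_def)
  \<comment> \<open>For i = j the old edge is the identity, which forces X = Y, so the order of the
    cases in \<open>row\<close> does not matter.\<close>
  have XY: "X = Y" if "i = j"
    using T N1(2)[OF ij] that Tri_None_iff[OF L X(1) Y(1)] by simp
  have flexQ: "Tri X Q Z" "Tri Y Q Z" "Tri Q Q Z" "Tri Q X Z" "Tri Q Y Z"
    if "Z \<in> L" "Z \<noteq> {None}" for Z
    using flex[OF Q(2) that] Tri_swap12 by blast+
  have new: "Tri (row l) (row m) (N l m)" if "l < k" "m < k" for l m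
  proof (cases "l = m")
    case True
    then have "N l m = {None}" using N1 that by blast
    then show ?thesis using True Tri_None_iff[OF L row(1) row(1)] by simp
  next
    case False
    then have "N l m \<noteq> {None}" using N1 that by blast
    moreover have "Tri Y X (N j i)" using T N1(3)[OF ij] Tri_swap12 by metis
    ultimately show ?thesis
      using flexQ[OF N1(1)[OF that]] T XY False by (auto simp: row_def)
  qed
  have new': "Tri (row l) (N l m) (row m)" "Tri (N l m) (row m) (row l)" if "l < k" "m < k" for l m
    using new[OF that] Tri_swap12 Tri_swap23 by blast+
  have refl: "Tri Z Z {None}" "Tri {None} Z Z" "Tri Z {None} Z" if "Z \<in> L" for Z
    using Tri_None[OF LD(1,2)[OF that]] Tri_swap12 Tri_swap23 by blast+
  define N' where "N' l m = (if l = k \<and> m = k then {None} else if m = k then row l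
     else if l = k then row m else N l m)" for l m
  have "net L (Suc k) N'"
    unfolding net_def
  proof (intro conjI allI impI)
    fix l m assume lm: "l < Suc k" "m < Suc k"
    then show "N' l m \<in> L"
      using N1(1) row(1) LD(3) by (auto simp: N'_def less_Suc_eq)
    show "N' l m = N' m l"
      using lm N1(3) by (auto simp: N'_def less_Suc_eq)
    show "N' l m = {None} \<longleftrightarrow> l = m"
      using lm N1(2)[of l m] row(2)[of l] row(2)[of m] unfolding N'_def less_Suc_eq by metis
  next
    fix l m r assume lm: "l < Suc k" "m < Suc k" "r < Suc k"
    then show "Tri (N' l r) (N' r m) (N' l m)"
      using lm N1(1) N2 row(1) new new' refl LD(3)
      by (auto simp: N'_def less_Suc_eq)
  qed
  moreover have "\<forall>l<k. \<forall>m<k. N' l m = N l m" "N' i k = X" "N' k j = Y"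
    using ij XY by (auto simp: N'_def row_def)
  ultimately show ?thesis by blast
qed

end

section \<open>Saturated labellings, built step by step\<close>

lemma ex_recurrent_enumeration:
  assumes "countable Q" "Q \<noteq> {}"
  shows "\<exists>d::nat \<Rightarrow> 'q. (\<forall>m. d m \<in> Q) \<and> (\<forall>q\<in>Q. \<forall>b. \<exists>m\<ge>b. d m = q)"
proof -
  \<comment> \<open>The second component of the pair code is a dummy: varying it repeats each task
    at arbitrarily late stages, in particular after the points it mentions have been added.\<close>
  define d where "d m = from_nat_into Q (fst (prod_decode m))" for m
  have "\<exists>m\<ge>b. d m = q" if "q \<in> Q" for q b
    using that assms le_prod_encode_2[of b "to_nat_on Q q"]
    by (intro exI[of _ "prod_encode (to_nat_on Q q, b)"]) (simp add: d_def)
  moreover have "\<forall>m. d m \<in> Q" using assms by (simp add: d_def from_nat_into)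
  ultimately show ?thesis by blast
qed

context split_structure
begin

lemma ex_saturated_labelling:
  fixes L :: "('a \<times> 'i::linorder) option set set"
  assumes L: "labelling L" and "countable L" and K: "K \<noteq> {}"
  shows "\<exists>M::nat \<Rightarrow> nat \<Rightarrow> _. (\<forall>k. net L k M) \<and>
    (\<forall>s t. \<forall>X\<in>L. \<forall>Y\<in>L. Tri X Y (M s t) \<longrightarrow> (\<exists>r. M s r = X \<and> M r t = Y))"
proof -
  note LD = labellingD[OF L]
  \<comment> \<open>A task (i, j, X, Y) asks for a point r with label X from i and Y to j. Identity
    labels are left out because \<open>net_extend\<close> excludes them; at the end r = s or r = t
    deals with them.\<close>
  define Q where "Q = (UNIV :: nat set) \<times> (UNIV :: nat set) \<times> (L - {{None}}) \<times> (L - {{None}})"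
  obtain X0 where X0: "X0 \<in> L" "X0 \<noteq> {None}"
  proof -
    obtain x where "x \<in> K" using K by blast
    then obtain X where "X \<in> L" "Some (x, undefined) \<in> X" using LD(5)[of "Some (x, undefined)"] by auto
    then show ?thesis using that[of X] by blast
  qed
  have "countable Q" "Q \<noteq> {}" using assms(2) X0 by (auto simp: Q_def)
  from ex_recurrent_enumeration[OF this] obtain d :: "nat \<Rightarrow> _"
    where d: "\<forall>m. d m \<in> Q" "\<forall>q\<in>Q. \<forall>b. \<exists>m\<ge>b. d m = q" by blast
  define handled where "handled m N N' \<longleftrightarrow> (case d m of (i, j, X, Y) \<Rightarrow>
      i \<le> m \<and> j \<le> m \<and> Tri X Y (N i j) \<longrightarrow> (\<exists>r. r \<le> Suc m \<and> N' i r = X \<and> N' r j = Y))"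
    for m and N N' :: "nat \<Rightarrow> nat \<Rightarrow> ('a \<times> 'i) option set"
  define ext where "ext m N N' \<longleftrightarrow> (\<forall>l\<le>m. \<forall>r\<le>m. N' l r = N l r) \<and> handled m N N'"
    for m and N N' :: "nat \<Rightarrow> nat \<Rightarrow> ('a \<times> 'i) option set"
  have "\<exists>F. \<forall>m. net L (Suc m) (F m) \<and> ext m (F m) (F (Suc m))"
  proof (rule dependent_nat_choice)
    have "Tri {None} {None} ({None} :: ('a \<times> 'i) option set)"
      using Tri_None[of "{None}"] by simp
    then show "\<exists>N. net L (Suc 0) N"
      by (intro exI[of _ "\<lambda>_ _. {None}"]) (simp add: net_def LD(3))
  next
    fix N m assume N: "net L (Suc m) N"
    obtain i j X Y where dm: "d m = (i, j, X, Y)" by (metis prod_cases4)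
    then have XY: "X \<in> L" "X \<noteq> {None}" "Y \<in> L" "Y \<noteq> {None}" using d(1)[rule_format, of m] by (auto simp: Q_def)
    show "\<exists>N'. net L (Suc (Suc m)) N' \<and> ext m N N'"
    proof (cases "i \<le> m \<and> j \<le> m \<and> Tri X Y (N i j)")
      case True
      then obtain N' where "net L (Suc (Suc m)) N'" "\<forall>l<Suc m. \<forall>r<Suc m. N' l r = N l r"
        "N' i (Suc m) = X" "N' (Suc m) j = Y"
        using net_extend[OF L N _ _ XY, of i j] by (auto simp: less_Suc_eq_le)
      then show ?thesis
        by (intro exI[of _ N']) (auto simp: ext_def handled_def dm less_Suc_eq_le)
    next
      case False
      \<comment> \<open>A task that does not apply still adds a point, linked to 0 by the dummy
        label \<open>X0\<close>, so that the network of stage m has exactly the points up to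
        m.\<close>
      have "N 0 0 = {None}" using N by (simp add: net_def)
      then have "Tri X0 X0 (N 0 0)" using Tri_None_iff[OF L X0(1) X0(1)] by simp
      then obtain N' where "net L (Suc (Suc m)) N'" "\<forall>l<Suc m. \<forall>r<Suc m. N' l r = N l r"
        using net_extend[OF L N _ _ X0 X0, of 0 0] by auto
      then show ?thesis using False
        by (intro exI[of _ N']) (auto simp: ext_def handled_def dm less_Suc_eq_le)
    qed
  qed
  then obtain F where F: "\<And>m. net L (Suc m) (F m)" "\<And>m. ext m (F m) (F (Suc m))" by blast
  define M where "M s t = F (max s t) s t" for s t
  have M: "F m s t = M s t" if "s \<le> m" "t \<le> m" for m s t
  proof -
    have "max s t \<le> m" using that by simp
    then show ?thesis
    proof (induction m rule: dec_induct)
      case base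
      show ?case by (simp add: M_def)
    next
      case (step n)
      then show ?case using F(2)[of n] by (simp add: ext_def)
    qed
  qed
  have nets: "net L k M" for k
  proof -
    have "net L (Suc k) (F k)" by (rule F(1))
    moreover have "F k s t = M s t" if "s < Suc k" "t < Suc k" for s t
      using M[of s k t] that by simp
    ultimately have "net L (Suc k) M" unfolding net_def by metis
    then show ?thesis unfolding net_def by (metis less_SucI)
  qed
  have "\<exists>r. M s r = X \<and> M r t = Y" if XY: "X \<in> L" "Y \<in> L" and T: "Tri X Y (M s t)" for s t X Y
  proof -
    have Mst: "M s t \<in> L" "M s s = {None}" "M t t = {None}"
      using nets[of "Suc (max s t)"] by (auto simp: net_def less_Suc_eq_le)
    consider "X = {None}" | "Y = {None}" | "X \<noteq> {None}" "Y \<noteq> {None}" by blast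
    then show ?thesis
    proof cases
      case 1
      then have "Y = M s t"
        using Tri_swap23[OF Tri_swap12[OF T]] Tri_None_iff[OF L XY(2) Mst(1)] by simp
      then show ?thesis using 1 Mst by blast
    next
      case 2
      then have "X = M s t"
        using Tri_swap23[OF T] Tri_None_iff[OF L XY(1) Mst(1)] by simp
      then show ?thesis using 2 Mst by blast
    next
      case 3
      then have "(s, t, X, Y) \<in> Q" using XY by (simp add: Q_def)
      then obtain m where m: "m \<ge> max s t" "d m = (s, t, X, Y)" using d(2) by blast
      then have "handled m (F m) (F (Suc m))" using F(2)[of m] by (simp add: ext_def)
      moreover have "F m s t = M s t" using m M by simp
      ultimately obtain r where "r \<le> Suc m" "F (Suc m) s r = X" "F (Suc m) r t = Y"
        using m T by (auto simp: handled_def)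
      then show ?thesis using M[of s "Suc m" r] M[of r "Suc m" t] m(1) by auto
    qed
  qed
  then show ?thesis using nets by blast
qed

end

section \<open>Stable sets\<close>

context split_structure
begin

text \<open>These sets form the algebra D_n: from index n on, membership depends on the colour
  alone, so X contains or avoids each \<open>tail p n\<close>.\<close>

definition stable :: "nat \<Rightarrow> ('a \<times> nat) option set \<Rightarrow> bool" where
  "stable n X \<longleftrightarrow> X \<subseteq> pts \<and> (\<forall>x\<in>K. \<forall>y\<in>K. \<forall>i\<ge>n. \<forall>j\<ge>n.
     col x = col y \<longrightarrow> Some (x, i) \<in> X \<longrightarrow> Some (y, j) \<in> X)"

lemma stable_pts: "stable n X \<Longrightarrow> X \<subseteq> pts"
  by (simp add: stable_def)

lemma stableD:
  assumes "stable n X" "Some (x, i) \<in> X" "y \<in> K" "n \<le> i" "n \<le> j" "col y = col x"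
  shows "Some (y, j) \<in> X"
proof -
  have "x \<in> K" using subsetD[OF stable_pts assms(2)] assms(1) by simp
  then show ?thesis using assms unfolding stable_def by metis
qed

lemma stable_mono: "stable n X \<Longrightarrow> n \<le> m \<Longrightarrow> stable m X"
  unfolding stable_def by (meson order_trans)

lemma stable_Un: "stable n X \<Longrightarrow> stable n Y \<Longrightarrow> stable n (X \<union> Y)"
  unfolding stable_def by (metis UnE UnI1 UnI2 Un_least)

lemma stable_Compl: "stable n X \<Longrightarrow> stable n (pts - X)"
  unfolding stable_def by (metis Diff_iff Diff_subset Some_pts)

lemma stable_None: "stable n {None}"
  by (simp add: stable_def)

lemma stable_singleton: "x \<in> K \<Longrightarrow> i < n \<Longrightarrow> stable n {Some (x, i)}"
  by (simp add: stable_def)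

lemma comp_pts: "comp X Y \<subseteq> pts"
  using tri_pts by (auto simp: comp_def)

text \<open>A consistent triangle on \<open>Some (z, k)\<close> is turned into one on
  \<open>Some (z', k')\<close>. If the three colours are not all equal, z may be exchanged for z'
  and the indices do not matter. Otherwise the largest index is at least n and is attained twice, so
  u or v also has index at least n and may be moved inside its stable set.\<close>

lemma stable_comp:
  assumes X: "stable n X" and Y: "stable n Y"
  shows "stable n (comp X Y)"
proof -
  have "Some (z', k') \<in> comp X Y"
    if z: "z \<in> K" "z' \<in> K" "n \<le> k" "n \<le> k'" "col z = col z'" and w: "Some (z, k) \<in> comp X Y"
    for z z' k k'
  proof -
    obtain u v where uv: "u \<in> X" "v \<in> Y" "tri u v (Some (z, k))"
      using w by (auto simp: comp_def)
    show ?thesis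
    proof (cases "u = None \<or> v = None")
      case True
      then have "None \<in> X \<and> Some (z', k') \<in> Y \<or> None \<in> Y \<and> Some (z', k') \<in> X"
        using uv stableD[OF X _ z(2-4) z(5)[symmetric]] stableD[OF Y _ z(2-4) z(5)[symmetric]]
        by auto
      moreover have "tri None (Some (z', k')) (Some (z', k'))" "tri (Some (z', k')) None (Some (z', k'))"
        using z by simp_all
      ultimately show ?thesis unfolding comp_def by blast
    next
      case False
      then obtain x i y j where u: "u = Some (x, i)" and v: "v = Some (y, j)" by auto
      have K: "x \<in> K" "y \<in> K" and R: "R x y z"
        and U: "col x = col y \<and> col y = col z \<longrightarrow> ultra i j k"
        using uv(3) by (simp_all add: u v)
      have "\<exists>u'\<in>X. \<exists>v'\<in>Y. tri u' v' (Some (z', k'))"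
      proof (cases "col x = col y \<and> col y = col z")
        case False
        then have "R x y z'" using R_col[OF K z(1) R False K z(2)] z(5) by simp
        then have "tri u v (Some (z', k'))" using False K z by (auto simp: u v)
        then show ?thesis using uv by blast
      next
        case True
        \<comment> \<open>Rotating the triangle lets \<open>R_col_eq\<close> supply a replacement
          for y or for x once z has become z'.\<close>
        have "R x z y" "R y z x" using R R_swap12 R_swap23 K z(1) by blast+
        then obtain y' x' where y': "y' \<in> K" "col y' = col x" "R x z' y'"
          and x': "x' \<in> K" "col x' = col y" "R y z' x'"
          using R_col_eq[OF K(1) z(1) K(2) _ _ _ K(1) z(2) refl]
            R_col_eq[OF K(2) z(1) K(1) _ _ _ K(2) z(2) refl] True z(5) by metis
        have Rx: "R x y' z'" "R x' y z'"
          using x' y' R_swap12 R_swap23 K z(2) by blast+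
        have U: "ultra i j k" using U True by blast
        consider "n \<le> i" "j < n" "i = k" | "n \<le> j" | "i < n" "j < n"
          using U z(3) by (force simp: ultra_def)
        then show ?thesis
        proof cases
          case 1
          then have "Some (x', k') \<in> X" using stableD[OF X _ x'(1) _ z(4), of x i] x'(2) True uv(1) u by simp
          moreover have "tri (Some (x', k')) v (Some (z', k'))"
            using 1 x' Rx K z by (simp add: v ultra_def)
          ultimately show ?thesis using uv by blast
        next
          case 2
          then have Y': "Some (y', k') \<in> Y" using stableD[OF Y _ y'(1) _ z(4), of y j] y'(2) True uv(2) v by simp
          \<comment> \<open>With y moved to index k', the index of x must not exceed k': it is kept
            if it is below n and otherwise reset to k'.\<close>
          have "\<exists>i'. Some (x, i') \<in> X \<and> i' \<le> k'"
          proof (cases "n \<le> i")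
            case True
            then show ?thesis using stableD[OF X _ K(1) _ z(4)] uv(1) u by blast
          next
            case False
            then show ?thesis using uv(1) u z(4) by (intro exI[of _ i]) simp
          qed
          then obtain i' where "Some (x, i') \<in> X" "i' \<le> k'" by blast
          moreover from this have "tri (Some (x, i')) (Some (y', k')) (Some (z', k'))"
            using y' Rx K z by (simp add: ultra_def)
          ultimately show ?thesis using Y' by blast
        next
          case 3
          then show ?thesis using U z(3) by (auto simp: ultra_def)
        qed
      qed
      then show ?thesis by (simp add: comp_def)
    qed
  qed
  then show ?thesis using comp_pts unfolding stable_def by blast
qed

text \<open>Such a set is determined by its points of index at most n, where index n stands for the
  whole tail; there are finitely many such points.\<close>

lemma finite_stable: "finite {X. stable n X}"
proof -
  let ?F = "insert None (Some ` (K \<times> {..n}))"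
  have "inj_on (\<lambda>X. X \<inter> ?F) {X. stable n X}"
  proof (rule inj_onI, clarify)
    have "X \<subseteq> Y" if X: "stable n X" and Y: "stable n Y" and eq: "X \<inter> ?F = Y \<inter> ?F" for X Y
    proof
      fix u assume u: "u \<in> X"
      show "u \<in> Y"
      proof (cases u)
        case None
        then show ?thesis using u eq by blast
      next
        case (Some a)
        obtain x i where a: "a = (x, i)" by (cases a)
        have x: "x \<in> K" using subsetD[OF stable_pts[OF X] u] Some a by simp
        show ?thesis
        proof (cases "i \<le> n")
          case True
          then have "u \<in> ?F" using x Some a by simp
          then show ?thesis using u eq by blast
        next
          case False
          then have "Some (x, n) \<in> X" using stableD[OF X, of x i x n] u Some a x by simp
          moreover have "Some (x, n) \<in> ?F" using x by simp
          ultimately have "Some (x, n) \<in> Y" using eq by blast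
          then show ?thesis using stableD[OF Y, of x n x i] x False Some a by simp
        qed
      qed
    qed
    then show "X = Y" if "stable n X" "stable n Y" "X \<inter> ?F = Y \<inter> ?F" for X Y
      using that by (metis subset_antisym)
  qed
  moreover have "finite ((\<lambda>X. X \<inter> ?F) ` {X. stable n X})"
    by (rule finite_subset[of _ "Pow ?F"]) (auto simp: finite_K)
  ultimately show ?thesis by (rule finite_imageD[rotated])
qed

definition stab :: "('a \<times> nat) option set set" where
  "stab = {X. \<exists>n. stable n X}"

lemma stab_common: "finite S \<Longrightarrow> S \<subseteq> stab \<Longrightarrow> \<exists>n. \<forall>X\<in>S. stable n X"
proof (induction S rule: finite_induct)
  case (insert X S)
  then obtain n m where "\<forall>Y\<in>S. stable n Y" "stable m X" by (auto simp: stab_def)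
  then show ?case
    by (intro exI[of _ "max n m"]) (auto intro: stable_mono)
qed simp

lemma stab_common2:
  assumes "X \<in> stab" "Y \<in> stab"
  obtains n where "stable n X" "stable n Y"
  using stab_common[of "{X, Y}"] assms by auto

lemma stab_closed:
  "{None} \<in> stab" "X \<in> stab \<Longrightarrow> pts - X \<in> stab"
  "X \<in> stab \<Longrightarrow> Y \<in> stab \<Longrightarrow> X \<union> Y \<in> stab"
  "X \<in> stab \<Longrightarrow> Y \<in> stab \<Longrightarrow> comp X Y \<in> stab"
  using stable_None stable_Compl stable_Un stable_comp
  by (auto simp: stab_def elim: stab_common2) (metis stab_common2 mem_Collect_eq stab_def)+

lemma stab_singleton: assumes "u \<in> pts" shows "{u} \<in> stab"
proof (cases u)
  case None
  then show ?thesis using stab_closed(1) by simp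
next
  case (Some a)
  then show ?thesis
    using assms stable_singleton[of "fst a" "snd a", OF _ lessI] by (cases a) (auto simp: stab_def)
qed

end

section \<open>Representation by limit labels\<close>

text \<open>\<open>cap\<close> and \<open>uncap\<close> move between \<omega> + 1 and \<omega>. Both
  are monotone, so by \<open>tri_map\<close> they preserve consistent triangles, which is how
  compositions are compared in \<open>lift_comp\<close>.\<close>

definition cap :: "nat \<Rightarrow> enat \<Rightarrow> nat" where
  "cap N k = (case k of enat i \<Rightarrow> min i N | \<infinity> \<Rightarrow> N)"

definition uncap :: "nat \<Rightarrow> nat \<Rightarrow> enat" where
  "uncap N k = (if k < N then enat k else \<infinity>)"

lemma cap_simps [simp]: "cap N (enat i) = min i N" "cap N \<infinity> = N"
  by (simp_all add: cap_def)

lemma cap_uncap [simp]: "cap N (uncap N k) = min k N"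
  by (simp add: uncap_def)

lemma mono_cap: "mono (cap N)"
proof (rule monoI)
  show "cap N k \<le> cap N l" if "k \<le> l" for k l
    using that by (cases k; cases l) auto
qed

lemma mono_uncap: "mono (uncap N)"
  by (auto simp: mono_def uncap_def)

abbreviation pmap :: "('i \<Rightarrow> 'j) \<Rightarrow> ('a \<times> 'i) option \<Rightarrow> ('a \<times> 'j) option" where
  "pmap f \<equiv> map_option (map_prod id f)"

context split_structure
begin

lemma pmap_pts [simp]: "pmap f u \<in> pts \<longleftrightarrow> u \<in> pts"
  by (cases u) auto

text \<open>The points at infinity stand for the nonprincipal ultrafilters: such a point belongs to
  \<open>lift X\<close> iff its colour class is eventually contained in \<open>X\<close>.\<close>

definition lift :: "('a \<times> nat) option set \<Rightarrow> ('a \<times> enat) option set" where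
  "lift X = {u \<in> pts. \<exists>n. \<forall>N\<ge>n. pmap (cap N) u \<in> X}"

text \<open>A single test suffices: truncations at two levels N, N' >= n give either the same index
  or two indices that are at least n, which stability does not distinguish.\<close>

lemma mem_lift_iff:
  assumes X: "stable n X" and N: "n \<le> N" and u: "u \<in> pts"
  shows "u \<in> lift X \<longleftrightarrow> pmap (cap N) u \<in> X"
proof -
  have *: "pmap (cap N') u \<in> X" if "n \<le> N" "n \<le> N'" "pmap (cap N) u \<in> X" for N N'
  proof (cases u)
    case None
    then show ?thesis using that by simp
  next
    case (Some a)
    obtain x k where a: "a = (x, k)" by (cases a)
    have x: "x \<in> K" using u Some a by simp
    show ?thesis
    proof (cases "cap N k = cap N' k")
      case True
      then show ?thesis using that Some a by simp
    next
      case False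
      then have "n \<le> cap N k" "n \<le> cap N' k" using that(1,2) by (cases k; auto)+
      then show ?thesis using stableD[OF X _ x] that(3) Some a by auto
    qed
  qed
  show ?thesis
  proof
    assume "u \<in> lift X"
    then obtain m where "\<forall>N\<ge>m. pmap (cap N) u \<in> X" by (auto simp: lift_def)
    then have "pmap (cap (max m n)) u \<in> X" by simp
    then show "pmap (cap N) u \<in> X" using *[of "max m n" N] N by simp
  next
    assume "pmap (cap N) u \<in> X"
    then show "u \<in> lift X" using * N u by (auto simp: lift_def)
  qed
qed

lemma lift_pts: "lift X \<subseteq> pts"
  by (auto simp: lift_def)

lemma lift_Un: assumes "X \<in> stab" "Y \<in> stab" shows "lift (X \<union> Y) = lift X \<union> lift Y"
proof -
  obtain n where n: "stable n X" "stable n Y" using stab_common2 assms by blast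
  show ?thesis
    using mem_lift_iff[OF n(1) order_refl] mem_lift_iff[OF n(2) order_refl]
      mem_lift_iff[OF stable_Un[OF n] order_refl] lift_pts by blast
qed

lemma lift_Compl: assumes "X \<in> stab" shows "lift (pts - X) = pts - lift X"
proof -
  obtain n where n: "stable n X" using assms by (auto simp: stab_def)
  show ?thesis
    using mem_lift_iff[OF n order_refl] mem_lift_iff[OF stable_Compl[OF n] order_refl]
      lift_pts pmap_pts by blast
qed

lemma lift_None: "lift {None} = {None}"
  by (auto simp: lift_def)

text \<open>A triangle over \<omega> whose third point is a truncation of w is pulled up along
  \<open>uncap N\<close>; a triangle over \<omega> + 1 is pushed down along
  \<open>cap n\<close>.\<close>

lemma lift_comp:
  assumes "X \<in> stab" "Y \<in> stab"
  shows "lift (comp X Y) = comp (lift X) (lift Y)"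
proof -
  obtain n where n: "stable n X" "stable n Y" using stab_common2 assms by blast
  note X = mem_lift_iff[OF n(1)] and Y = mem_lift_iff[OF n(2)]
    and XY = mem_lift_iff[OF stable_comp[OF n]]
  show ?thesis
  proof (intro equalityI subsetI)
    fix w assume w: "w \<in> lift (comp X Y)"
    then have wp: "w \<in> pts" using lift_pts by blast
    \<comment> \<open>N must strictly exceed a finite index of w, since \<open>uncap N\<close> sends
      N itself to infinity.\<close>
    obtain N where N: "n \<le> N" "pmap (uncap N) (pmap (cap N) w) = w"
    proof (cases w)
      case None
      then show ?thesis using that[of n] by simp
    next
      case (Some a)
      obtain z k where a: "a = (z, k)" by (cases a)
      show ?thesis
      proof (cases k)
        case (enat i)
        then show ?thesis using that[of "max n (Suc i)"] Some a
          by (simp add: uncap_def)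
      next
        case infinity
        then show ?thesis using that[of n] Some a by (simp add: uncap_def)
      qed
    qed
    have "pmap (cap N) w \<in> comp X Y" using w wp N XY by blast
    then obtain u v where uv: "u \<in> X" "v \<in> Y" "tri u v (pmap (cap N) w)"
      by (auto simp: comp_def)
    have *: "pmap (uncap N) u \<in> lift X" if X: "stable n X" and u: "u \<in> X" for u X
    proof -
      have p: "u \<in> pts" using X u stable_pts by blast
      have "pmap (cap N) (pmap (uncap N) u) \<in> X"
      proof (cases u)
        case (Some a)
        obtain x i where a: "a = (x, i)" by (cases a)
        show ?thesis
        proof (cases "i \<le> N")
          case False
          then show ?thesis using stableD[OF X, of x i x N] N(1) p u Some a by (simp add: min_def)
        qed (use u Some a in \<open>simp add: min_def\<close>)
      qed (use u in simp)
      then show ?thesis using mem_lift_iff[OF X N(1)] p by simp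
    qed
    have "tri (pmap (uncap N) u) (pmap (uncap N) v) w"
      using tri_map[OF mono_uncap[of N] uv(3)] N(2) by simp
    then show "w \<in> comp (lift X) (lift Y)"
      using *[OF n(1) uv(1)] *[OF n(2) uv(2)] unfolding comp_def by blast
  next
    fix w assume "w \<in> comp (lift X) (lift Y)"
    then obtain u v where uv: "u \<in> lift X" "v \<in> lift Y" "tri u v w" by (auto simp: comp_def)
    then have p: "u \<in> pts" "v \<in> pts" "w \<in> pts" using tri_pts by blast+
    have "pmap (cap n) u \<in> X" "pmap (cap n) v \<in> Y" using uv X Y p by blast+
    moreover have "tri (pmap (cap n) u) (pmap (cap n) v) (pmap (cap n) w)"
      using tri_map[OF mono_cap uv(3)] .
    ultimately have "pmap (cap n) w \<in> comp X Y" unfolding comp_def by blast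
    then show "w \<in> lift (comp X Y)" using XY[OF order_refl p(3)] by blast
  qed
qed

text \<open>Points at infinity of one colour share a label because lifted stable sets do not
  separate them.\<close>

definition limit_labels :: "('a \<times> enat) option set set" where
  "limit_labels = {{None}} \<union> (\<lambda>(x, i). {Some (x, enat i)}) ` (K \<times> UNIV) \<union> (\<lambda>x. tail x \<infinity>) ` K"

lemma tail_infinity: "Some (v, k) \<in> tail x (\<infinity>::enat) \<longleftrightarrow> v \<in> K \<and> col v = col x \<and> k = \<infinity>"
  "None \<notin> tail x n"
  by (auto simp: tail_def)

lemma limit_labels_cases:
  assumes "Q \<in> limit_labels"
  obtains "Q = {None}" | x i where "x \<in> K" "Q = {Some (x, enat i)}" | x where "x \<in> K" "Q = tail x \<infinity>"
  using assms by (auto simp: limit_labels_def)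

lemma labelling_limit: "labelling limit_labels"
  unfolding labelling_def
proof (intro conjI ballI allI impI)
  show "Q \<noteq> {}" "Q \<subseteq> pts" if "Q \<in> limit_labels" for Q
    using that by (auto elim!: limit_labels_cases simp: tail_def)
  show "X = Y" if X: "X \<in> limit_labels" and Y: "Y \<in> limit_labels" and u: "u \<in> X" "u \<in> Y" for X Y u
    using X
  proof (cases rule: limit_labels_cases)
    case 1
    then show ?thesis using Y u by (auto elim!: limit_labels_cases simp: tail_infinity)
  next
    case (2 x i)
    then show ?thesis using Y u by (auto elim!: limit_labels_cases simp: tail_infinity)
  next
    case (3 x)
    then show ?thesis using Y u by (auto elim!: limit_labels_cases simp: tail_def)
  qed
  show "\<exists>X\<in>limit_labels. u \<in> X" if "u \<in> pts" for u
  proof (cases u)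
    case None
    then show ?thesis by (auto simp: limit_labels_def)
  next
    case (Some a)
    obtain x k where a: "a = (x, k)" by (cases a)
    then have "x \<in> K" using that Some by simp
    show ?thesis
    proof (cases k)
      case (enat i)
      then have "{u} \<in> limit_labels" using Some a \<open>x \<in> K\<close> by (force simp: limit_labels_def)
      then show ?thesis by blast
    next
      case infinity
      then have "u \<in> tail x \<infinity>" using Some a \<open>x \<in> K\<close> by (simp add: tail_infinity)
      moreover have "tail x \<infinity> \<in> limit_labels" using \<open>x \<in> K\<close> by (simp add: limit_labels_def)
      ultimately show ?thesis by blast
    qed
  qed
  show "{None} \<in> limit_labels" by (simp add: limit_labels_def)
  \<comment> \<open>The threshold is infinity itself: there the tails are labels.\<close>
  show "\<exists>n. \<forall>p\<in>K. \<exists>Q\<in>limit_labels. tail p n \<subseteq> Q"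
    by (rule exI[of _ \<infinity>]) (auto simp: limit_labels_def)
qed

lemma countable_limit_labels: "countable limit_labels"
  using finite_K by (auto simp: limit_labels_def countable_finite)

text \<open>This is the ultrafilter property of labels. For limit labels it holds because membership
  in X at high indices depends on the colour only.\<close>

lemma limit_label_decides:
  assumes X: "X \<in> stab" and Q: "Q \<in> limit_labels" and u: "u \<in> Q" "u \<in> lift X"
  shows "Q \<subseteq> lift X"
proof -
  obtain n where n: "stable n X" using X by (auto simp: stab_def)
  show ?thesis using Q
  proof (cases rule: limit_labels_cases)
    case (3 x)
    then obtain v where v: "u = Some (v, \<infinity>)" "v \<in> K" "col v = col x"
      using u by (cases u) (auto simp: tail_infinity)
    then have "Some (v, n) \<in> X" using u mem_lift_iff[OF n order_refl, of u] by simp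
    then have "Some (w, n) \<in> X" if "w \<in> K" "col w = col x" for w
      using stableD[OF n _ that(1) order_refl order_refl] that v by simp
    then show ?thesis using mem_lift_iff[OF n order_refl] 3
      by (auto simp: tail_def)
  qed (use u in auto)
qed

text \<open>An edge of a saturated labelling is put into h X when its label lies inside
  \<open>lift X\<close>. Labels decide stable sets, which gives the Boolean laws; saturation and
  consistency of triangles give the two inclusions for composition.\<close>

theorem stab_representation:
  assumes K: "K \<noteq> {}"
  shows "\<exists>h :: _ \<Rightarrow> (nat \<times> nat) set. inj_on h stab \<and>
     (\<forall>X\<in>stab. \<forall>Y\<in>stab. h (X \<union> Y) = h X \<union> h Y \<and> h (comp X Y) = h X O h Y) \<and>
     (\<forall>X\<in>stab. h (pts - X) = - h X \<and> (h X)\<inverse> = h X) \<and> h {None} = Id"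
proof -
  let ?L = limit_labels
  note L = labelling_limit and LD = labellingD[OF labelling_limit]
  from ex_saturated_labelling[OF L countable_limit_labels K]
  obtain M where "\<forall>k. net ?L k M" and M_sat: "\<forall>s t. \<forall>X\<in>?L. \<forall>Y\<in>?L. Tri X Y (M s t) \<longrightarrow> (\<exists>r. M s r = X \<and> M r t = Y)"
    by (elim exE conjE)
  then have nets: "net ?L k M" for k by simp
  have sat: "\<exists>r. M s r = X \<and> M r t = Y" if "X \<in> ?L" "Y \<in> ?L" "Tri X Y (M s t)" for s t X Y
    using that M_sat by simp
  have M1: "M s t \<in> ?L" "M s t = {None} \<longleftrightarrow> s = t" "M s t = M t s" for s t
    using nets[of "Suc (max s t)"] unfolding net_def by (metis le_imp_less_Suc max.cobounded1 max.cobounded2)+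
  have M2: "Tri (M s r) (M r t) (M s t)" for s r t
  proof -
    have "s < Suc (max s (max r t))" "r < Suc (max s (max r t))" "t < Suc (max s (max r t))" by auto
    then show ?thesis using nets[of "Suc (max s (max r t))"] unfolding net_def by blast
  qed
  have M0: "M s t \<noteq> {}" for s t using LD(1)[OF M1(1)] .
  have dec: "u \<in> lift X \<longleftrightarrow> M s t \<subseteq> lift X" if "X \<in> stab" "u \<in> M s t" for X s t u
    using limit_label_decides[OF that(1) M1(1) that(2)] that(2) by blast
  define h where "h X = {(s, t). M s t \<subseteq> lift X}" for X
  have h: "(s, t) \<in> h X \<longleftrightarrow> M s t \<subseteq> lift X" for s t X by (simp add: h_def)
  have h_mem: "(s, t) \<in> h X \<longleftrightarrow> u \<in> lift X" if "X \<in> stab" "u \<in> M s t" for s t X u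
    using dec[OF that] h by blast
  \<comment> \<open>The identity is consistent with Q, Q, so saturation at the edge (0, 0) yields an
    edge labelled Q. That every label occurs makes h injective.\<close>
  have occurs: "\<exists>t. M 0 t = Q" if Q: "Q \<in> ?L" for Q
  proof -
    have "Tri Q Q (M 0 0)" using Tri_None_iff[OF L Q Q] M1(2)[of 0 0] by simp
    then show ?thesis using sat[OF Q Q] by blast
  qed
  have subset: "X \<subseteq> Y" if X: "X \<in> stab" and Y: "Y \<in> stab" and XY: "h X \<subseteq> h Y" for X Y
  proof
    fix u assume u: "u \<in> X"
    obtain n where n: "stable n X" "stable n Y" using stab_common2 X Y by blast
    have up: "u \<in> pts" using u stable_pts[OF n(1)] by blast
    let ?u = "pmap enat u"
    have cap: "pmap (cap N) ?u = u" if "\<forall>x i. u = Some (x, i) \<longrightarrow> i \<le> N" for N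
      using that by (cases u) (auto simp: min_def)
    obtain N where N: "n \<le> N" "pmap (cap N) ?u = u"
    proof (cases u)
      case None
      then show ?thesis using that[of n] by simp
    next
      case (Some a)
      then show ?thesis using that[of "max n (snd a)"] by (cases a) simp
    qed
    have in_lift: "?u \<in> lift Z \<longleftrightarrow> u \<in> Z" if "stable n Z" for Z
      using mem_lift_iff[OF that N(1), of ?u] N(2) up by simp
    obtain Q where Q: "Q \<in> ?L" "?u \<in> Q" using LD(5)[of ?u] up by auto
    obtain t where t: "M 0 t = Q" using occurs[OF Q(1)] by blast
    have "?u \<in> lift X" using in_lift[OF n(1)] u by simp
    then have "(0, t) \<in> h X" using h_mem[OF X] Q t by blast
    then have "(0, t) \<in> h Y" using XY by blast
    then have "?u \<in> lift Y" using h_mem[OF Y] Q t by blast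
    then show "u \<in> Y" using in_lift[OF n(2)] by simp
  qed
  have "inj_on h stab"
    by (rule inj_onI) (simp add: subset subset_antisym)
  moreover have "h (X \<union> Y) = h X \<union> h Y" if "X \<in> stab" "Y \<in> stab" for X Y
  proof -
    have "(s, t) \<in> h (X \<union> Y) \<longleftrightarrow> (s, t) \<in> h X \<union> h Y" for s t
    proof -
      obtain u where u: "u \<in> M s t" using M0 by blast
      show ?thesis
        using h_mem[OF stab_closed(3)[OF that] u] h_mem[OF that(1) u] h_mem[OF that(2) u]
          lift_Un[OF that] by simp
    qed
    then show ?thesis by auto
  qed
  moreover have "h (pts - X) = - h X" if "X \<in> stab" for X
  proof -
    have "(s, t) \<in> h (pts - X) \<longleftrightarrow> (s, t) \<in> - h X" for s t
    proof -
      obtain u where u: "u \<in> M s t" using M0 by blast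
      then have "u \<in> pts" using LD(2)[OF M1(1)] by blast
      then show ?thesis
        using h_mem[OF stab_closed(2)[OF that] u] h_mem[OF that u] lift_Compl[OF that] by simp
    qed
    then show ?thesis by auto
  qed
  moreover have "h (comp X Y) = h X O h Y" if XY: "X \<in> stab" "Y \<in> stab" for X Y
  proof (intro equalityI subsetI)
    fix q assume q: "q \<in> h (comp X Y)"
    obtain s t where st: "q = (s, t)" by (cases q)
    obtain w where w: "w \<in> M s t" using M0 by blast
    have "w \<in> comp (lift X) (lift Y)"
      using h_mem[OF stab_closed(4)[OF XY] w] q st lift_comp[OF XY] by simp
    then obtain u v where uv: "u \<in> lift X" "v \<in> lift Y" "tri u v w" by (auto simp: comp_def)
    then obtain P Q where PQ: "P \<in> ?L" "u \<in> P" "Q \<in> ?L" "v \<in> Q"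
      using tri_pts LD(5) by metis
    then have "Tri P Q (M s t)" using uv w unfolding Tri_def by blast
    then obtain r where r: "M s r = P" "M r t = Q" using sat PQ by blast
    then have "(s, r) \<in> h X" "(r, t) \<in> h Y"
      using h_mem[OF XY(1)] h_mem[OF XY(2)] PQ uv by blast+
    then show "q \<in> h X O h Y" using st by blast
  next
    fix q assume "q \<in> h X O h Y"
    then obtain s r t where q: "q = (s, t)" "(s, r) \<in> h X" "(r, t) \<in> h Y" by blast
    obtain u v w where uvw: "u \<in> M s r" "v \<in> M r t" "w \<in> M s t" "tri u v w"
      using M2[of s r t] by (auto simp: Tri_def)
    have "u \<in> lift X" "v \<in> lift Y" using q uvw h_mem[OF XY(1)] h_mem[OF XY(2)] by blast+
    then have "w \<in> comp (lift X) (lift Y)"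
      using uvw unfolding comp_def by blast
    then have "w \<in> lift (comp X Y)"
      by (simp only: lift_comp[OF XY])
    then show "q \<in> h (comp X Y)" using h_mem[OF stab_closed(4)[OF XY] uvw(3)] q by blast
  qed
  moreover have "(h X)\<inverse> = h X" for X
    using M1(3) by (auto simp: h_def)
  moreover have "h {None} = Id"
  proof -
    have "(s, t) \<in> h {None} \<longleftrightarrow> s = t" for s t
      using M1(2)[of s t] M0[of s t] h by (auto simp: lift_None subset_singleton_iff)
    then show ?thesis by auto
  qed
  ultimately show ?thesis by (intro exI[of _ h]) blast
qed

end

section \<open>From special extensions to split structures\<close>

locale special_pair =
  fixes E A :: "'a ra"
  assumes raE: "is_ra E" and raA: "is_ra A"
    and finE: "finite (car E)" and finA: "finite (car A)"
    and subEA: "subalgebra E A"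
    and intE: "integral E" and symE: "symmetric E" and intA: "integral A" and symA: "symmetric A"
    and special: "special_extension A E"
    and trio: "has_flexible_trio E"
begin

sublocale A: sym_rel_alg A
  using raA symA by unfold_locales

sublocale E: sym_rel_alg E
  using raE symE by unfold_locales

lemma E_ops:
  "x \<in> car E \<Longrightarrow> x \<in> car A" "x \<in> car E \<Longrightarrow> cm E x = cm A x"
  "x \<in> car E \<Longrightarrow> y \<in> car E \<Longrightarrow> jn E x y = jn A x y"
  "x \<in> car E \<Longrightarrow> y \<in> car E \<Longrightarrow> cp E x y = cp A x y"
  "x \<in> car E \<Longrightarrow> y \<in> car E \<Longrightarrow> ra_le E x y = ra_le A x y"
  "idt E = idt A"
  using subEA by (auto simp: subalgebra_def ra_le_def)

lemma zero_E: "ra_zero E = ra_zero A" and div_E: "ra_div E = ra_div A"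
proof -
  have 1: "idt A \<in> car E" using E.clos(1) E_ops(6) by simp
  have 2: "cm A (idt A) \<in> car E" using E.clos(2)[OF 1] E_ops(2)[OF 1] by simp
  have 3: "cm A (cm A (idt A)) \<in> car E" using E.clos(2)[OF 2] E_ops(2)[OF 2] by simp
  have 4: "jn A (cm A (idt A)) (cm A (cm A (idt A))) \<in> car E"
    using E.clos(4)[OF 2 3] E_ops(3)[OF 2 3] by simp
  show "ra_zero E = ra_zero A"
    unfolding ra_zero_def ra_meet_def
    using E_ops(2)[OF 1] E_ops(2)[OF 2] E_ops(2)[OF 4] E_ops(3)[OF 2 3] E_ops(6) by simp
  show "ra_div E = ra_div A"
    unfolding ra_div_def using E_ops(2)[OF 1] E_ops(6) by simp
qed

lemma div_clos [simp]: "ra_div A \<in> car A"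
  by (simp add: ra_div_def)

lemma E_clos: "ra_atom E e \<Longrightarrow> e \<in> car E" "ra_atom E e \<Longrightarrow> e \<in> car A"
  "div_atom E e \<Longrightarrow> e \<in> car E" "div_atom E e \<Longrightarrow> e \<in> car A"
  using E_ops(1) by (auto simp: ra_atom_def div_atom_def)

text \<open>Otherwise e lies below the complement of y, and x would lie below both y and that
  complement. This lets inequalities for atoms of A pass to their colours.\<close>

lemma A_atom_below_E:
  assumes x: "ra_atom A x" and e: "ra_atom E e" and y: "y \<in> car E"
    and xe: "ra_le A x e" and xy: "ra_le A x y"
  shows "ra_le A e y"
proof (rule ccontr)
  assume "\<not> ra_le A e y"
  then have "ra_le E e (cm E y)" using E.atom_le_compl[OF e y] E_ops(5) E_clos(1)[OF e] y by simp
  then have "ra_le A e (cm A y)" using E_ops(5)[OF E_clos(1)[OF e] E.clos(2)[OF y]] E_ops(2)[OF y] by simp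
  then have "ra_le A x (cm A y)"
    using A.le_trans[OF xe _ A.atom_clos(1)[OF x] E_clos(2)[OF e] A.clos(2)[OF E_ops(1)[OF y]]] by blast
  then show False using A.atom_le_compl[OF x E_ops(1)[OF y]] xy by blast
qed

text \<open>Pick e in E above x with the fewest elements of E below it. For y in E below e, either x
  <= y and minimality gives y = e, or x lies below the meet of e with -y, which by minimality equals
  e, so y = 0.\<close>

lemma ex_E_atom:
  assumes x: "ra_atom A x"
  shows "\<exists>e. ra_atom E e \<and> ra_le A x e"
proof -
  have xc: "x \<in> car A" using x by (rule A.atom_clos)
  define P where "P e \<longleftrightarrow> e \<in> car E \<and> ra_le A x e" for e
  have one: "E.one = A.one"
    unfolding E.one_def A.one_def
    using E_ops(2,3)[of "idt A"] E_ops(3)[of "idt A" "cm A (idt A)"] E.clos(1) E.clos(2)[OF E.clos(1)] E_ops(6)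
    by (simp add: E_ops)
  have "ra_le A x A.one" using A.atom_le_compl[OF x A.zero_clos] A.le_zeroD x
    by (auto simp: ra_atom_def)
  then have "P A.one" using E.one_clos one by (simp add: P_def)
  then obtain e where e: "P e" and least: "\<And>y. P y \<Longrightarrow> card {z \<in> car E. ra_le A z e} \<le> card {z \<in> car E. ra_le A z y}"
    using ex_has_least_nat[of P A.one "\<lambda>y. card {z \<in> car E. ra_le A z y}"] by blast
  have ec: "e \<in> car E" "e \<in> car A" "ra_le A x e" using e E_ops(1) by (auto simp: P_def)
  have min: "y = e" if y: "P y" "ra_le A y e" for y
  proof -
    have yc: "y \<in> car E" "y \<in> car A" using y E_ops(1) by (auto simp: P_def)
    have "{z \<in> car E. ra_le A z y} \<subseteq> {z \<in> car E. ra_le A z e}"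
      using A.le_trans[OF _ y(2) _ yc(2) ec(2)] E_ops(1) by blast
    then have "{z \<in> car E. ra_le A z y} = {z \<in> car E. ra_le A z e}"
      using least[OF y(1)] finE by (intro card_seteq) auto
    then have "ra_le A e y" using ec A.le_refl[OF ec(2)] by blast
    then show ?thesis using A.le_antisym[OF y(2)] yc ec by blast
  qed
  have "ra_atom E e"
    unfolding ra_atom_def
  proof (intro conjI ballI impI)
    show "e \<in> car E" by (rule ec)
    show "e \<noteq> ra_zero E"
      using ec(3) x A.le_zeroD xc unfolding zero_E ra_atom_def by blast
    fix y assume y: "y \<in> car E" "ra_le E y e"
    have yA: "y \<in> car A" "ra_le A y e" using y E_ops(1) E_ops(5)[OF y(1) ec(1)] by auto
    show "y = ra_zero E \<or> y = e"
    proof (cases "ra_le A x y")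
      case True
      then show ?thesis using min[of y] y yA by (simp add: P_def)
    next
      case False
      then have xy: "ra_le A x (cm A y)" using A.atom_le_compl[OF x yA(1)] by blast
      let ?m = "ra_meet E e (cm E y)"
      have m: "?m \<in> car E" using ec y by simp
      have mA: "?m = ra_meet A e (cm A y)"
        unfolding ra_meet_def using ec(1) y(1) by (simp add: E_ops(2,3)[symmetric])
      have "P ?m" unfolding P_def using m mA A.le_meetI[OF ec(3) xy ec(2) _ xc] yA by simp
      moreover have "ra_le A ?m e" using mA A.meet_le1 ec yA by simp
      ultimately have "?m = e" using min by blast
      then have "ra_le E e (cm E y)" using E.meet_le2[OF ec(1) E.clos(2)[OF y(1)]] by simp
      then have "ra_le E y (cm E y)" using E.le_trans[OF y(2) _ y(1) ec(1) E.clos(2)[OF y(1)]] by blast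
      then have "ra_le E y (ra_meet E y (cm E y))" using E.le_meetI[of y y "cm E y"] y(1) by simp
      then have "y = ra_zero E" using E.le_zeroD E.meet_compl[OF y(1)] y(1) by simp
      then show ?thesis ..
    qed
  qed
  then show ?thesis using ec by blast
qed

lemma cE_eqI:
  assumes "ra_atom A x" "ra_atom E e" "ra_le A x e"
  shows "cE E A x = e"
  unfolding cE_def
proof (rule the_equality)
  show "ra_atom E e \<and> ra_le A x e" using assms by blast
  fix f assume f: "ra_atom E f \<and> ra_le A x f"
  show "f = e"
    using A.le_antisym[of f e] A_atom_below_E[of x e f] A_atom_below_E[of x f e] assms f E_clos(1,2) by blast
qed

lemma cE_atom: assumes "ra_atom A x" shows "ra_atom E (cE E A x)" "ra_le A x (cE E A x)"
  using ex_E_atom[OF assms] cE_eqI[OF assms] by auto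

abbreviation "diva \<equiv> {x. div_atom A x}"

lemma divaD: assumes "x \<in> diva" shows "ra_atom A x" "x \<in> car A" "ra_le A x (ra_div A)"
  using assms A.atom_clos by (auto simp: div_atom_def)

lemma cE_div: assumes "x \<in> diva" shows "div_atom E (cE E A x)" "ra_le A x (cE E A x)"
proof -
  note x = divaD[OF assms]
  let ?e = "cE E A x"
  note e = cE_atom[OF x(1)]
  show "ra_le A x ?e" by (rule e)
  have "ra_div A \<in> car E" using div_E by (metis E.clos(1,2) ra_div_def)
  then have "ra_le A ?e (ra_div A)" using A_atom_below_E[OF x(1) e(1) _ e(2) x(3)] by blast
  then show "div_atom E ?e"
    using e(1) E_ops(5)[OF E_clos(1)[OF e(1)]] \<open>ra_div A \<in> car E\<close> div_E by (simp add: div_atom_def)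
qed

lemma diva_below:
  assumes e: "div_atom E e" and x: "ra_atom A x" "ra_le A x e"
  shows "x \<in> diva" "cE E A x = e"
proof -
  have "ra_le A e (ra_div A)"
    using e E_ops(5)[OF E_clos(3)[OF e], of "ra_div E"] div_E E.clos(1,2)
    by (simp add: div_atom_def ra_div_def)
  then have "ra_le A x (ra_div A)"
    using A.le_trans[OF x(2) _ A.atom_clos(1)[OF x(1)] E_clos(4)[OF e] div_clos] by blast
  then show "x \<in> diva" using x by (simp add: div_atom_def)
  show "cE E A x = e" using cE_eqI x e by (simp add: div_atom_def)
qed

lemma ex_diva_below: assumes e: "div_atom E e" shows "\<exists>x\<in>diva. cE E A x = e"
proof -
  have "e \<noteq> ra_zero A" using e zero_E by (simp add: div_atom_def ra_atom_def)
  then obtain x where "ra_atom A x" "ra_le A x e"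
    using A.ex_atom[OF finA E_clos(4)[OF e]] by blast
  then show ?thesis using diva_below[OF e] by blast
qed

section \<open>Cycles of atoms and flexible colours\<close>

abbreviation "cyc x y z \<equiv> ra_le A z (cp A x y)"

lemma cyc_swap12: "x \<in> diva \<Longrightarrow> y \<in> diva \<Longrightarrow> z \<in> diva \<Longrightarrow> cyc x y z \<Longrightarrow> cyc y x z"
  using A.cp_comm divaD(2) by metis

lemma cyc_swap23: "x \<in> diva \<Longrightarrow> y \<in> diva \<Longrightarrow> z \<in> diva \<Longrightarrow> cyc x y z \<Longrightarrow> cyc x z y"
  using A.peirce divaD(1,2) by metis

text \<open>The element c(x);c(y) belongs to E and lies above z, hence above the atom c(z) of
  E.\<close>

lemma cyc_E:
  assumes x: "x \<in> diva" and y: "y \<in> diva" and z: "z \<in> diva" and "cyc x y z"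
  shows "cyc (cE E A x) (cE E A y) (cE E A z)"
proof -
  note ex = cE_div[OF x] and ey = cE_div[OF y] and ez = cE_div[OF z]
  have "ra_le A (cp A x y) (cp A (cE E A x) (cE E A y))"
    using A.cp_mono[OF ex(2) ey(2)] divaD(2)[OF x] divaD(2)[OF y] E_clos(4)[OF ex(1)] E_clos(4)[OF ey(1)] by blast
  then have "cyc (cE E A x) (cE E A y) z"
    using A.le_trans[OF assms(4)] divaD(2)[OF x] divaD(2)[OF y] divaD(2)[OF z]
      E_clos(4)[OF ex(1)] E_clos(4)[OF ey(1)] by simp
  moreover have "cp A (cE E A x) (cE E A y) \<in> car E"
    using E_ops(4)[OF E_clos(3)[OF ex(1)] E_clos(3)[OF ey(1)]] E.clos(5)[OF E_clos(3)[OF ex(1)] E_clos(3)[OF ey(1)]]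
    by simp
  ultimately show ?thesis
    using A_atom_below_E[OF divaD(1)[OF z]] ez by (simp add: div_atom_def)
qed

lemma special1:
  assumes "div_atom E a" "div_atom E b" "div_atom E c" "\<not> (a = b \<and> b = c)" "cyc a b c"
    and x: "x \<in> diva" "cE E A x = a" and y: "y \<in> diva" "cE E A y = b" and z: "z \<in> diva" "cE E A z = c"
  shows "cyc x y z"
proof -
  have "ra_le A x a" "ra_le A y b" "ra_le A z c" using cE_div(2)[OF x(1)] cE_div(2)[OF y(1)] cE_div(2)[OF z(1)] x(2) y(2) z(2) by simp_all
  then have "ra_le A c (cp A x y)"
    using special assms(1-5) divaD(1)[OF x(1)] divaD(1)[OF y(1)] unfolding special_extension_def by meson
  then show ?thesis
    using A.le_trans[OF \<open>ra_le A z c\<close>] divaD(2) x(1) y(1) z(1) E_clos(4)[OF assms(3)] by simp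
qed

lemma special2:
  assumes a: "div_atom E a" "cyc a a a" and x: "x \<in> diva" "cE E A x = a" and y: "y \<in> diva" "cE E A y = a"
  shows "\<exists>z\<in>diva. cE E A z = a \<and> cyc x y z"
proof -
  have le: "ra_le A x a" "ra_le A y a" using cE_div(2)[OF x(1)] cE_div(2)[OF y(1)] x(2) y(2) by simp_all
  have c: "cp A x y \<in> car A" "a \<in> car A" using divaD(2) x(1) y(1) E_clos(4)[OF a(1)] by simp_all
  have "ra_meet A (cp A x y) a \<noteq> ra_zero A"
    using special[unfolded special_extension_def, rule_format, of a a a] a le
      divaD(1)[OF x(1)] divaD(1)[OF y(1)] by simp
  from A.ex_atom[OF finA A.meet_clos[OF c] this]
  obtain z where z: "ra_atom A z" "ra_le A z (ra_meet A (cp A x y) a)" by blast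
  have "ra_le A z a" "cyc x y z"
    using A.le_trans[OF z(2) A.meet_le2] A.le_trans[OF z(2) A.meet_le1] A.atom_clos(1)[OF z(1)] c by simp_all
  then show ?thesis using diva_below[OF a(1) z(1)] by blast
qed

lemma div_E_atom_le: "div_atom E g \<Longrightarrow> ra_le A g (ra_div A)" "div_atom E g \<Longrightarrow> ra_le A g (ra_top A)"
proof -
  assume g: "div_atom E g"
  have "ra_div E \<in> car E" by (simp add: ra_div_def)
  then show "ra_le A g (ra_div A)" using g E_ops(5)[OF E_clos(3)[OF g], of "ra_div E"] div_E by (simp add: div_atom_def)
  have "ra_le A (ra_zero A) (cm A g)" using E_clos(4)[OF g] by simp
  then show "ra_le A g (ra_top A)"
    using A.le_iff_compl[of g "ra_top A"] E_clos(4)[OF g] by (simp add: ra_top_def)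
qed

lemma top_E: "ra_top E = ra_top A"
  using E_ops(2)[OF E.zero_clos] zero_E by (simp add: ra_top_def)

lemma top_neq_div: "ra_top A \<noteq> ra_div A"
proof
  assume "ra_top A = ra_div A"
  then have "cm A (ra_top A) = cm A (ra_div A)" by simp
  then have "ra_zero A = idt A" by (simp add: ra_top_def ra_div_def)
  then show False using intA by (simp add: integral_def ra_atom_def)
qed

text \<open>Every diversity atom of E, the trio included, is compatible with at least two members of
  the trio other than itself; two such pairs out of three elements share a member.\<close>

lemma flexible_colour:
  assumes e: "div_atom E e" and f: "div_atom E f"
  shows "\<exists>q. div_atom E q \<and> q \<noteq> e \<and> q \<noteq> f \<and> cp A e q = ra_div A \<and> cp A f q = ra_div A \<and> cp A q q = ra_top A"
proof -
  obtain a b c where t: "flexible_trio E a b c" using trio by (auto simp: has_flexible_trio_def)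
  then have abc: "div_atom E a" "div_atom E b" "div_atom E c"
    and sq: "cp E a a = ra_top E" "cp E b b = ra_top E" "cp E c c = ra_top E"
    and pr: "cp E a b = ra_div E" "cp E a c = ra_div E" "cp E b c = ra_div E"
    and oth: "\<And>x. ra_atom E x \<Longrightarrow> x \<notin> {idt E, a, b, c} \<Longrightarrow>
        (cp E x a = ra_div E \<and> cp E x b = ra_div E) \<or>
        (cp E x a = ra_div E \<and> cp E x c = ra_div E) \<or>
        (cp E x b = ra_div E \<and> cp E x c = ra_div E)"
    unfolding flexible_trio_def by blast+
  have pr': "cp E b a = ra_div E" "cp E c a = ra_div E" "cp E c b = ra_div E"
    using pr E.cp_comm E_clos(3)[OF abc(1)] E_clos(3)[OF abc(2)] E_clos(3)[OF abc(3)] by metis+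
  \<comment> \<open>Squares in the trio are 1 and mixed products are 0', which differ because the
    identity is not zero.\<close>
  have ne: "a \<noteq> b" "a \<noteq> c" "b \<noteq> c" using sq pr top_neq_div top_E div_E by metis+
  define good where "good e q \<longleftrightarrow> q \<noteq> e \<and> cp E e q = ra_div E" for e q
  have two: "(good e a \<and> good e b) \<or> (good e a \<and> good e c) \<or> (good e b \<and> good e c)" if e: "div_atom E e" for e
  proof -
    have "e \<noteq> idt E"
    proof
      assume "e = idt E"
      then have "ra_le E (idt E) (cm E (idt E))" using e by (simp add: div_atom_def ra_div_def)
      then show False using E.atom_le_compl[of "idt E" "idt E"] intE by (simp add: integral_def)
    qed
    moreover have "ra_atom E e" using e by (simp add: div_atom_def)
    ultimately show ?thesis
      using oth[of e] ne pr pr' unfolding good_def by (cases "e \<in> {a, b, c}") auto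
  qed
  obtain q where q: "q \<in> {a, b, c}" "good e q" "good f q" using two[OF e] two[OF f] by blast
  have "div_atom E q" "cp E q q = ra_top E" using q(1) abc sq by auto
  then show ?thesis
    using q(2,3) E_ops(4) E_clos(3) e f top_E div_E by (intro exI[of _ q]) (simp add: good_def)
qed

sublocale split_structure diva "cE E A" cyc
proof unfold_locales
  show "finite diva" by (rule finite_subset[OF _ finA]) (auto dest: A.atom_clos(2))
next
  fix x y z assume "x \<in> diva" "y \<in> diva" "z \<in> diva" "cyc x y z"
  then show "cyc y x z" "cyc x z y" using cyc_swap12 cyc_swap23 by blast+
next
  fix x y z x' y' z'
  assume xyz: "x \<in> diva" "y \<in> diva" "z \<in> diva" "cyc x y z" "\<not> (cE E A x = cE E A y \<and> cE E A y = cE E A z)"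
    and *: "x' \<in> diva" "y' \<in> diva" "z' \<in> diva" "cE E A x' = cE E A x" "cE E A y' = cE E A y" "cE E A z' = cE E A z"
  show "cyc x' y' z'"
    using special1[OF cE_div(1)[OF xyz(1)] cE_div(1)[OF xyz(2)] cE_div(1)[OF xyz(3)] xyz(5)
        cyc_E[OF xyz(1-4)] *(1,4) *(2,5) *(3,6)] .
next
  fix x y z x' y'
  assume xyz: "x \<in> diva" "y \<in> diva" "z \<in> diva" "cyc x y z" "cE E A x = cE E A y" "cE E A y = cE E A z"
    and *: "x' \<in> diva" "y' \<in> diva" "cE E A x' = cE E A x" "cE E A y' = cE E A x"
  have "cyc (cE E A x) (cE E A x) (cE E A x)" using cyc_E[OF xyz(1-4)] xyz(5,6) by simp
  then show "\<exists>z'\<in>diva. cE E A z' = cE E A x \<and> cyc x' y' z'"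
    using special2[OF cE_div(1)[OF xyz(1)] _ *(1,3) *(2,4)] by blast
next
  fix x y assume x: "x \<in> diva" and y: "y \<in> diva"
  note ex = cE_div(1)[OF x] and ey = cE_div(1)[OF y]
  obtain q where q: "div_atom E q" "q \<noteq> cE E A x" "q \<noteq> cE E A y"
    "cp A (cE E A x) q = ra_div A" "cp A (cE E A y) q = ra_div A" "cp A q q = ra_top A"
    using flexible_colour[OF ex ey] by blast
  obtain p where p: "p \<in> diva" "cE E A p = q" using ex_diva_below[OF q(1)] by blast
  have "cyc x p z \<and> cyc y p z \<and> (\<exists>u\<in>diva. \<exists>v\<in>diva. cE E A u = q \<and> cE E A v = q \<and> cyc u v z)"
    if z: "z \<in> diva" for z
  proof -
    note ez = cE_div(1)[OF z]
    have "cyc x p z"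
      using special1[OF ex q(1) ez _ _ x refl p z refl] q div_E_atom_le(1)[OF ez] by auto
    moreover have "cyc y p z"
      using special1[OF ey q(1) ez _ _ y refl p z refl] q div_E_atom_le(1)[OF ez] by auto
    moreover have "\<exists>u\<in>diva. \<exists>v\<in>diva. cE E A u = q \<and> cE E A v = q \<and> cyc u v z"
    \<comment> \<open>The first clause of special extensions does not cover the triple q, q, q.
      There the second clause yields an atom v below q with z;p >= v, and rotating this cycle gives
      p;v >= z.\<close>
    proof (cases "cE E A z = q")
      case True
      obtain v where v: "v \<in> diva" "cE E A v = q" "cyc z p v"
        using special2[OF q(1) _ z True p] q(6) div_E_atom_le(2)[OF q(1)] by auto
      then have "cyc p v z" using cyc_swap12 cyc_swap23 z p by blast
      then show ?thesis using p v by blast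
    next
      case False
      then have "cyc p p z"
        using special1[OF q(1) q(1) ez _ _ p p z refl] q(6) div_E_atom_le(2)[OF ez] by auto
      then show ?thesis using p by blast
    qed
    ultimately show ?thesis by blast
  qed
  then show "\<exists>p\<in>diva. cE E A p \<noteq> cE E A x \<and> cE E A p \<noteq> cE E A y \<and>
      (\<forall>z\<in>diva. cyc x p z \<and> cyc y p z \<and>
        (\<exists>u\<in>diva. \<exists>v\<in>diva. cE E A u = cE E A p \<and> cE E A v = cE E A p \<and> cyc u v z))"
    using p q by (intro bexI[of _ p]) auto
qed

lemma diva_nonempty: "diva \<noteq> {}"
  using trio ex_diva_below by (auto simp: has_flexible_trio_def flexible_trio_def)

end

section \<open>The algebra generated by the atoms\<close>

lemma closed_sub_gen_univ:
  assumes "S \<subseteq> X" "closed_sub C X"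
  shows "S \<subseteq> gen_univ C S" "closed_sub C (gen_univ C S)" "gen_univ C S \<subseteq> X"
proof -
  show "S \<subseteq> gen_univ C S" and *: "gen_univ C S \<subseteq> X"
    using assms by (auto simp: gen_univ_def)
  have "X \<subseteq> car C" using assms by (simp add: closed_sub_def)
  with * show "closed_sub C (gen_univ C S)"
    by (auto simp: closed_sub_def gen_univ_def)
qed

context special_pair
begin

lemma CAt_eq: "CAt A = pts"
  by (auto simp: CAt_def pts_def)

lemma Ctri_eq: "Ctri E A u v w \<longleftrightarrow> tri u v w"
proof
  have T: "T3 i j k \<longleftrightarrow> ultra i j k" for i j k by (simp add: T3_def ultra_def)
  have base: "tri u v w" if "Cbase E A u v w" for u v w
    using that unfolding Cbase_def T by auto
  show "tri u v w" if "Ctri E A u v w"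
    using that base tri_swap12 tri_swap23 unfolding Ctri_def by blast
  show "Ctri E A u v w" if "tri u v w"
    using that unfolding Ctri_def Cbase_def T
    by (cases u; cases v; cases w) auto
qed

definition B where "B = gen_univ (CEA E A) {X. ra_atom (CEA E A) X}"

lemma BEA_eq: "BEA E A = restrict_ra (CEA E A) B"
  by (simp add: BEA_def B_def)

lemma restrict_simps [simp]:
  "car (restrict_ra (CEA E A) X) = X" "jn (restrict_ra (CEA E A) X) Y Z = Y \<union> Z"
  "cm (restrict_ra (CEA E A) X) Y = pts - Y" "cp (restrict_ra (CEA E A) X) Y Z = comp Y Z"
  "cv (restrict_ra (CEA E A) X) Y = Y" "idt (restrict_ra (CEA E A) X) = {None}"
  "ra_zero (restrict_ra (CEA E A) X) = {}" "ra_le (restrict_ra (CEA E A) X) Y Z \<longleftrightarrow> Y \<subseteq> Z"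
  "ra_div (restrict_ra (CEA E A) X) = pts - {None}"
  "restrict_ra (restrict_ra (CEA E A) X) X' = restrict_ra (CEA E A) X'"
proof -
  show jn: "jn (restrict_ra (CEA E A) X) Y Z = Y \<union> Z"
    and cm: "cm (restrict_ra (CEA E A) X) Y = pts - Y"
    and idt: "idt (restrict_ra (CEA E A) X) = {None}" for X Y Z
    by (simp_all add: restrict_ra_def CEA_def CAt_eq)
  show "cp (restrict_ra (CEA E A) X) Y Z = comp Y Z"
    by (simp add: restrict_ra_def CEA_def comp_def Ctri_eq)
  show "ra_zero (restrict_ra (CEA E A) X) = {}" "ra_le (restrict_ra (CEA E A) X) Y Z \<longleftrightarrow> Y \<subseteq> Z"
    "ra_div (restrict_ra (CEA E A) X) = pts - {None}"
    unfolding ra_zero_def ra_meet_def ra_le_def ra_div_def jn cm idt by auto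
qed (simp_all add: restrict_ra_def CEA_def)

text \<open>Presents the full algebra as a restriction of itself, so that
  \<open>restrict_simps\<close> applies to it.\<close>

lemma CEA_restrict: "CEA E A = restrict_ra (CEA E A) (Pow pts)"
  by (simp add: restrict_ra_def CEA_def CAt_eq)

lemma closed_sub_iff:
  "closed_sub (restrict_ra (CEA E A) X) Y \<longleftrightarrow> Y \<subseteq> X \<and> {None} \<in> Y \<and>
     (\<forall>P\<in>Y. \<forall>Q\<in>Y. P \<union> Q \<in> Y \<and> comp P Q \<in> Y) \<and> (\<forall>P\<in>Y. pts - P \<in> Y)"
  unfolding closed_sub_def by auto

lemma ra_atom_restrict:
  "ra_atom (restrict_ra (CEA E A) X) Y \<longleftrightarrow> Y \<in> X \<and> Y \<noteq> {} \<and> (\<forall>Z\<in>X. Z \<subseteq> Y \<longrightarrow> Z = {} \<or> Z = Y)"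
  unfolding ra_atom_def by simp

lemma ra_atom_CEA: "ra_atom (CEA E A) X \<longleftrightarrow> (\<exists>u\<in>pts. X = {u})"
proof -
  have "ra_atom (CEA E A) X \<longleftrightarrow> X \<subseteq> pts \<and> X \<noteq> {} \<and> (\<forall>Z\<in>Pow pts. Z \<subseteq> X \<longrightarrow> Z = {} \<or> Z = X)"
    by (subst CEA_restrict) (simp add: ra_atom_restrict)
  also have "\<dots> \<longleftrightarrow> (\<exists>u\<in>pts. X = {u})"
  proof
    assume X: "X \<subseteq> pts \<and> X \<noteq> {} \<and> (\<forall>Z\<in>Pow pts. Z \<subseteq> X \<longrightarrow> Z = {} \<or> Z = X)"
    then obtain u where "u \<in> X" by blast
    then show "\<exists>u\<in>pts. X = {u}" using X by (intro bexI[of _ u]) auto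
  qed auto
  finally show ?thesis .
qed

text \<open>\<open>stab\<close> contains all singletons and is closed under the operations by
  \<open>stab_closed\<close>, so the algebra generated by the atoms stays inside it.\<close>

lemma B_props:
  shows B_closed: "closed_sub (CEA E A) B" and B_singleton: "u \<in> pts \<Longrightarrow> {u} \<in> B"
    and B_stab: "B \<subseteq> stab"
proof -
  let ?S = "{X. ra_atom (CEA E A) X}"
  have S: "?S \<subseteq> stab" using stab_singleton by (auto simp: ra_atom_CEA)
  have "stab \<subseteq> Pow pts" using stable_pts by (auto simp: stab_def)
  then have "closed_sub (CEA E A) stab"
    by (subst CEA_restrict) (simp add: closed_sub_iff stab_closed)
  note G = closed_sub_gen_univ[OF S this, folded B_def]
  show "closed_sub (CEA E A) B" "B \<subseteq> stab" using G by simp_all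
  show "{u} \<in> B" if "u \<in> pts" using G(1) that ra_atom_CEA by blast
qed

lemma B_ops:
  "{None} \<in> B" "X \<in> B \<Longrightarrow> Y \<in> B \<Longrightarrow> X \<union> Y \<in> B" "X \<in> B \<Longrightarrow> Y \<in> B \<Longrightarrow> comp X Y \<in> B"
  "X \<in> B \<Longrightarrow> pts - X \<in> B" "X \<in> B \<Longrightarrow> X \<subseteq> pts"
proof -
  have "closed_sub (restrict_ra (CEA E A) (Pow pts)) B"
    using B_closed CEA_restrict by simp
  then have *: "B \<subseteq> Pow pts \<and> {None} \<in> B \<and> (\<forall>P\<in>B. \<forall>Q\<in>B. P \<union> Q \<in> B \<and> comp P Q \<in> B) \<and> (\<forall>P\<in>B. pts - P \<in> B)"
    unfolding closed_sub_iff .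
  show "{None} \<in> B" "X \<in> B \<Longrightarrow> Y \<in> B \<Longrightarrow> X \<union> Y \<in> B" "X \<in> B \<Longrightarrow> Y \<in> B \<Longrightarrow> comp X Y \<in> B"
    "X \<in> B \<Longrightarrow> pts - X \<in> B" "X \<in> B \<Longrightarrow> X \<subseteq> pts"
    using * by auto
qed

text \<open>D is finite by \<open>finite_stable\<close>, and its atoms form a labelling with
  threshold n. Networks over it are exactly the atom matrices with the identity condition, so
  \<open>net_extend\<close> applies. Atomicity is stated too because the extension property is meant
  for atomic algebras.\<close>

lemma finite_closed_one_point_ext:
  assumes D: "closed_sub (restrict_ra (CEA E A) B) D" and n: "\<And>X. X \<in> D \<Longrightarrow> stable n X"
  shows "ra_atomic (restrict_ra (CEA E A) D)" "one_point_ext (restrict_ra (CEA E A) D)"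
proof -
  let ?C = "restrict_ra (CEA E A) D"
  define L where "L = {X. ra_atom ?C X}"
  have L: "X \<in> L \<longleftrightarrow> X \<in> D \<and> X \<noteq> {} \<and> (\<forall>Z\<in>D. Z \<subseteq> X \<longrightarrow> Z = {} \<or> Z = X)" for X
    by (simp add: L_def ra_atom_restrict)
  have D_ops: "{None} \<in> D" "\<And>X Y. X \<in> D \<Longrightarrow> Y \<in> D \<Longrightarrow> X \<union> Y \<in> D"
    "\<And>X Y. X \<in> D \<Longrightarrow> Y \<in> D \<Longrightarrow> comp X Y \<in> D" "\<And>X. X \<in> D \<Longrightarrow> pts - X \<in> D"
    using D unfolding closed_sub_iff by simp_all
  have D_pts: "X \<subseteq> pts" if "X \<in> D" for X using n[OF that] by (rule stable_pts)
  have D_Int: "X \<inter> Y \<in> D" if "X \<in> D" "Y \<in> D" for X Y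
  proof -
    have "X \<inter> Y = pts - ((pts - X) \<union> (pts - Y))" using D_pts that by blast
    then show ?thesis using D_ops that by simp
  qed
  have finD: "finite D" by (rule finite_subset[OF _ finite_stable[of n]]) (use n in blast)
  have pts_D: "pts \<in> D"
  proof -
    have "{None} \<union> (pts - {None}) = (pts :: ('a \<times> nat) option set)" by auto
    then show ?thesis using D_ops(2)[OF D_ops(1) D_ops(4)[OF D_ops(1)]] by (simp only:)
  qed
  \<comment> \<open>For a point u this is a finite intersection, so it belongs to D; closure under
    complement makes it an atom.\<close>
  define cell where "cell u = \<Inter>{X \<in> D. u \<in> X}" for u
  have cell_in: "u \<in> cell u" for u by (simp add: cell_def)
  have cell_least: "cell u \<subseteq> X" if "X \<in> D" "u \<in> X" for u X using that by (auto simp: cell_def)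
  have cell_D: "cell u \<in> D" if u: "u \<in> pts" for u
  proof -
    have "\<Inter>F \<in> D" if "finite F" "F \<noteq> {}" "F \<subseteq> D" for F
      using that by (induction F rule: finite_ne_induct) (auto intro: D_Int)
    moreover have "finite {X \<in> D. u \<in> X}" "{X \<in> D. u \<in> X} \<noteq> {}" using finD pts_D u by auto
    ultimately show ?thesis unfolding cell_def by blast
  qed
  have cell_L: "cell u \<in> L" if u: "u \<in> pts" for u
    unfolding L
  proof (intro conjI ballI impI)
    show "cell u \<in> D" using cell_D[OF u] .
    show "cell u \<noteq> {}" using cell_in by blast
    fix Z assume Z: "Z \<in> D" "Z \<subseteq> cell u"
    show "Z = {} \<or> Z = cell u"
    proof (cases "u \<in> Z")
      case True
      then show ?thesis using cell_least[OF Z(1)] Z(2) by blast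
    next
      case False
      then have "cell u \<subseteq> pts - Z" using cell_least[OF D_ops(4)[OF Z(1)]] u by blast
      then show ?thesis using Z(2) by blast
    qed
  qed
  have labelling: "labelling L"
    unfolding labelling_def
  proof (intro conjI ballI allI impI)
    show "X \<noteq> {}" "X \<subseteq> pts" if "X \<in> L" for X using that L D_pts by blast+
    show "X = Y" if "X \<in> L" "Y \<in> L" "u \<in> X" "u \<in> Y" for X Y u
    proof -
      have "X \<inter> Y \<in> D" "X \<inter> Y \<noteq> {}" using that L D_Int by auto
      then have "X \<inter> Y = X" "X \<inter> Y = Y" using that L by (metis inf_le1, metis inf_le2)
      then show ?thesis by simp
    qed
    show "\<exists>X\<in>L. u \<in> X" if "u \<in> pts" for u using cell_L[OF that] cell_in by blast
    show "{None} \<in> L" using D_ops(1) by (auto simp: L)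
    show "\<exists>n. \<forall>p\<in>diva. \<exists>Q\<in>L. tail p n \<subseteq> Q"
    proof (intro exI[of _ n] ballI)
      fix p assume p: "p \<in> diva"
      then have u: "Some (p, n) \<in> pts" by simp
      have "tail p n \<subseteq> cell (Some (p, n))"
        using stableD[OF n[OF cell_D[OF u]] cell_in] by (auto simp: tail_def)
      then show "\<exists>Q\<in>L. tail p n \<subseteq> Q" using cell_L[OF u] by blast
    qed
  qed
  have le_comp: "Z \<subseteq> comp X Y \<longleftrightarrow> Tri X Y Z" if "X \<in> L" "Y \<in> L" "Z \<in> L" for X Y Z
  proof -
    have "comp X Y \<inter> Z \<in> D" using that L D_Int D_ops(3) by simp
    moreover have "Z \<noteq> {}" using that L by simp
    ultimately have "Z \<subseteq> comp X Y \<longleftrightarrow> comp X Y \<inter> Z \<noteq> {}"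
      using that(3) L by (metis inf.absorb_iff2 inf_le2)
    also have "\<dots> \<longleftrightarrow> Tri X Y Z" by (auto simp: comp_def Tri_def)
    finally show ?thesis .
  qed
  have net: "in_Bk ?C k \<mu> \<and> id_cond ?C k \<mu> \<longleftrightarrow> net L k \<mu>" for k \<mu>
  proof -
    have "ra_atom ?C X \<longleftrightarrow> X \<in> L" for X by (simp add: L_def)
    then show ?thesis
      unfolding in_Bk_def id_cond_def net_def using le_comp
      by simp (smt (verit, ccfv_threshold) order_refl)
  qed
  show "ra_atomic ?C"
    unfolding ra_atomic_def
  proof (intro ballI impI)
    fix X assume "X \<in> car ?C" "X \<noteq> ra_zero ?C"
    then obtain u where "X \<in> D" "u \<in> X" by auto
    then show "\<exists>a. ra_atom ?C a \<and> ra_le ?C a X"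
      using cell_L[of u] cell_least[of X u] D_pts[of X] by (auto simp: L_def)
  qed
  show "one_point_ext ?C"
    unfolding one_point_ext_def
  proof (intro allI impI)
    fix k \<mu> X Y i j
    assume a: "in_Bk ?C k \<mu> \<and> id_cond ?C k \<mu> \<and> div_atom ?C X \<and> div_atom ?C Y \<and>
        i < k \<and> j < k \<and> i \<noteq> j \<and> ra_le ?C (\<mu> i j) (cp ?C X Y)"
    have X: "X \<in> L" "X \<noteq> {None}" and Y: "Y \<in> L" "Y \<noteq> {None}"
      using a by (auto simp: div_atom_def L_def)
    have N: "net L k \<mu>" using a net by blast
    then have "\<mu> i j \<in> L" using a by (simp add: net_def)
    then have "Tri X Y (\<mu> i j)" using a le_comp X Y by simp
    then obtain \<mu>' where "net L (Suc k) \<mu>'" "\<forall>l<k. \<forall>m<k. \<mu>' l m = \<mu> l m" "\<mu>' i k = X" "\<mu>' k j = Y"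
      using net_extend[OF labelling N _ _ X Y] a by blast
    then show "\<exists>\<mu>'. in_Bk ?C (Suc k) \<mu>' \<and> id_cond ?C (Suc k) \<mu>' \<and>
        (\<forall>l<k. \<forall>m<k. \<mu>' l m = \<mu> l m) \<and> \<mu>' i k = X \<and> \<mu>' k j = Y"
      using net by blast
  qed
qed

lemma finitely_generated_one_point_ext:
  assumes S: "finite S" "S \<subseteq> car (BEA E A)"
  shows "\<exists>D. closed_sub (BEA E A) D \<and> gen_univ (BEA E A) S \<subseteq> D \<and>
           ra_atomic (restrict_ra (BEA E A) D) \<and> one_point_ext (restrict_ra (BEA E A) D)"
proof -
  have SB: "S \<subseteq> B" using S(2) by (simp add: BEA_eq)
  then obtain n where n: "\<forall>X\<in>S. stable n X" using stab_common[OF S(1)] B_stab by blast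
  define D where "D = B \<inter> {X. stable n X}"
  have D: "closed_sub (restrict_ra (CEA E A) B) D"
    unfolding closed_sub_iff D_def
    using B_ops(1-4) stable_None stable_Un stable_comp stable_Compl by simp
  moreover have "gen_univ (restrict_ra (CEA E A) B) S \<subseteq> D"
    using closed_sub_gen_univ(3)[OF _ D] n SB by (auto simp: D_def)
  moreover have "stable n X" if "X \<in> D" for X using that by (simp add: D_def)
  ultimately show ?thesis
    using finite_closed_one_point_ext[OF D, of n] unfolding BEA_eq restrict_simps by blast
qed

lemma BEA_representable: "representable_over TYPE(nat) (BEA E A)"
proof -
  from stab_representation[OF diva_nonempty]
  obtain h :: "_ \<Rightarrow> (nat \<times> nat) set" where h: "inj_on h stab"
    "\<forall>X\<in>stab. \<forall>Y\<in>stab. h (X \<union> Y) = h X \<union> h Y \<and> h (comp X Y) = h X O h Y"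
    "\<forall>X\<in>stab. h (pts - X) = - h X \<and> (h X)\<inverse> = h X" "h {None} = Id"
    by (elim exE conjE)
  have F: "Field (UNIV :: (nat \<times> nat) set) = UNIV" by (auto simp: Field_def)
  have "is_representation (BEA E A) UNIV h"
    unfolding is_representation_def BEA_eq restrict_simps F
  proof (intro conjI ballI)
    show "equiv UNIV (UNIV :: (nat \<times> nat) set)"
      by (auto simp: equiv_def refl_on_def sym_def trans_def)
    show "inj_on h B" using h(1) B_stab inj_on_subset by blast
    show "h {None} = Id_on UNIV" using h(4) by (auto simp: Id_on_def)
  qed (use h subsetD[OF B_stab] in \<open>simp_all add: Compl_eq_Diff_UNIV\<close>)
  then show ?thesis unfolding representable_over_def by blast
qed

end

section \<open>Failure of complete representability\<close>

text \<open>Ramsey's theorem gives i < j < l whose pairs have one colour x, so (t i, t l) lies in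
  both \<open>H x O H x\<close> and \<open>H x\<close>.\<close>

lemma no_triangle_free_colouring:
  fixes H :: "'k \<Rightarrow> ('b \<times> 'b) set" and t :: "nat \<Rightarrow> 'b"
  assumes K: "finite K"
    and cover: "\<And>i j. i < j \<Longrightarrow> \<exists>x\<in>K. (t i, t j) \<in> H x"
    and free: "\<And>x. x \<in> K \<Longrightarrow> (H x O H x) \<inter> H x = {}"
  shows False
proof -
  obtain e :: "'k \<Rightarrow> nat" and n where e: "bij_betw e K {..<n}"
    using ex_bij_betw_finite_nat[OF K] by (auto simp: atLeast0LessThan)
  \<comment> \<open>Ramsey's theorem colours unordered pairs, while H x is not assumed symmetric:
    \<open>Min\<close> and \<open>Max\<close> restore the order.\<close>
  define c where "c P = (SOME x. x \<in> K \<and> (t (Min P), t (Max P)) \<in> H x)" for P :: "nat set"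
  have c: "c {i, j} \<in> K \<and> (t i, t j) \<in> H (c {i, j})" if "i < j" for i j
  proof -
    have "Min {i, j} = i" "Max {i, j} = j" using that by auto
    then show ?thesis
      unfolding c_def using someI_ex[of "\<lambda>x. x \<in> K \<and> (t i, t j) \<in> H x"] cover[OF that] by auto
  qed
  have "e (c {i, j}) < n" if "i \<noteq> j" for i j
  proof -
    have "c {i, j} \<in> K" using c[of i j] c[of j i] that by (cases "i < j") (auto simp: insert_commute)
    then show ?thesis using e by (auto simp: bij_betw_def)
  qed
  then obtain Y k where Y: "infinite Y" "\<forall>i\<in>Y. \<forall>j\<in>Y. i \<noteq> j \<longrightarrow> e (c {i, j}) = k"
    using Ramsey2[of "UNIV :: nat set" "\<lambda>P. e (c P)" n] by auto
  obtain i where i: "i \<in> Y" using Y(1) infinite_imp_nonempty by blast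
  obtain j where j: "j \<in> Y" "i < j" using Y(1) by (auto simp: infinite_nat_iff_unbounded)
  obtain l where l: "l \<in> Y" "j < l" using Y(1) by (auto simp: infinite_nat_iff_unbounded)
  have il: "i < l" using j l by simp
  have "e (c {i, j}) = k" "e (c {j, l}) = k" "e (c {i, l}) = k"
    using Y(2) i j l by auto
  then have "c {i, j} = c {i, l}" "c {j, l} = c {i, l}"
    using c[OF j(2)] c[OF l(2)] c[OF il] e unfolding bij_betw_def by (metis inj_onD)+
  then show False
    using c[OF j(2)] c[OF l(2)] c[OF il] free[of "c {i, l}"] by (metis disjoint_iff relcomp.relcompI)
qed

context special_pair
begin

abbreviation "is_B_rep \<equiv> is_representation (BEA E A)"

lemma is_B_rep_iff: "is_B_rep U h \<longleftrightarrow> equiv (Field U) U \<and> inj_on h B \<and> (\<forall>X\<in>B. h X \<subseteq> U) \<and>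
     (\<forall>X\<in>B. \<forall>Y\<in>B. h (X \<union> Y) = h X \<union> h Y) \<and> (\<forall>X\<in>B. h (pts - X) = U - h X) \<and>
     (\<forall>X\<in>B. \<forall>Y\<in>B. h (comp X Y) = h X O h Y) \<and> (\<forall>X\<in>B. h X = (h X)\<inverse>) \<and>
     h {None} = Id_on (Field U)"
  unfolding is_representation_def BEA_eq restrict_simps ..

lemma B_repD:
  assumes "is_B_rep U h"
  shows "equiv (Field U) U"
    "inj_on h B"
    "X \<in> B \<Longrightarrow> h X \<subseteq> U"
    "X \<in> B \<Longrightarrow> Y \<in> B \<Longrightarrow> h (X \<union> Y) = h X \<union> h Y"
    "X \<in> B \<Longrightarrow> h (pts - X) = U - h X"
    "X \<in> B \<Longrightarrow> Y \<in> B \<Longrightarrow> h (comp X Y) = h X O h Y"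
    "X \<in> B \<Longrightarrow> (h X)\<inverse> = h X"
    "h {None} = Id_on (Field U)"
proof -
  from assms have *: "equiv (Field U) U" "inj_on h B" "\<forall>X\<in>B. h X \<subseteq> U"
    "\<forall>X\<in>B. \<forall>Y\<in>B. h (X \<union> Y) = h X \<union> h Y" "\<forall>X\<in>B. h (pts - X) = U - h X"
    "\<forall>X\<in>B. \<forall>Y\<in>B. h (comp X Y) = h X O h Y" "\<forall>X\<in>B. h X = (h X)\<inverse>"
    "h {None} = Id_on (Field U)"
    unfolding is_B_rep_iff by - (elim conjE, assumption)+
  show "equiv (Field U) U" "inj_on h B" "h {None} = Id_on (Field U)"
    by (fact *)+
  show "X \<in> B \<Longrightarrow> h X \<subseteq> U" "X \<in> B \<Longrightarrow> Y \<in> B \<Longrightarrow> h (X \<union> Y) = h X \<union> h Y" "X \<in> B \<Longrightarrow> h (pts - X) = U - h X" "X \<in> B \<Longrightarrow> Y \<in> B \<Longrightarrow> h (comp X Y) = h X O h Y"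
    using *(3-6) by simp_all
  show "(h X)\<inverse> = h X" if "X \<in> B"
    using bspec[OF *(7) that] by (rule sym)
qed

lemma empty_pts_B: "{} \<in> B" "pts \<in> B"
proof -
  have "{None} \<union> (pts - {None}) = (pts :: ('a \<times> nat) option set)" by auto
  then show "pts \<in> B" using B_ops(2)[OF B_ops(1) B_ops(4)[OF B_ops(1)]] by (simp only:)
  from B_ops(4)[OF this] show "{} \<in> B" by simp
qed

lemma B_rep_basic:
  assumes h: "is_B_rep U h"
  shows "h {} = {}" "h pts = U" "X \<in> B \<Longrightarrow> Y \<in> B \<Longrightarrow> X \<subseteq> Y \<Longrightarrow> h X \<subseteq> h Y"
    "X \<in> B \<Longrightarrow> Y \<in> B \<Longrightarrow> X \<inter> Y = {} \<Longrightarrow> h X \<inter> h Y = {}"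
    "X \<in> B \<Longrightarrow> h X = {} \<Longrightarrow> X = {}"
proof -
  note un = B_repD(4)[OF h] and co = B_repD(5)[OF h] B_repD(3)[OF h]
  show top: "h pts = U"
  proof -
    have "h ({} \<union> (pts - {})) = h {} \<union> (U - h {})"
      using un[OF empty_pts_B(1) B_ops(4)[OF empty_pts_B(1)]] co(1)[OF empty_pts_B(1)] by simp
    then show ?thesis using co(2)[OF empty_pts_B(1)] by auto
  qed
  show emp: "h {} = {}" using co(1)[OF empty_pts_B(2)] top by simp
  show mono: "h X \<subseteq> h Y" if "X \<in> B" "Y \<in> B" "X \<subseteq> Y" for X Y
    using un[OF that(1,2)] Un_absorb1[OF that(3)] by auto
  show "h X \<inter> h Y = {}" if XY: "X \<in> B" "Y \<in> B" "X \<inter> Y = {}" for X Y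
  proof -
    have "h Y \<subseteq> h (pts - X)"
    proof (rule mono[OF XY(2) B_ops(4)[OF XY(1)]])
      show "Y \<subseteq> pts - X" using XY(3) B_ops(5)[OF XY(2)] by blast
    qed
    then show ?thesis using co(1)[OF XY(1)] by blast
  qed
  show "X = {}" if "X \<in> B" "h X = {}" for X
    using inj_onD[OF B_repD(2)[OF h] _ that(1) empty_pts_B(1)] that(2) emp by simp
qed

lemma point_B [simp]: "x \<in> diva \<Longrightarrow> {Some (x, i)} \<in> B"
  by (rule B_singleton) simp

text \<open>Since 1' <= x^(i);x^(i), a fixed point s has a successor along each copy of x, and
  disjointness of the copies makes these successors distinct. They lie in one block of the
  equivalence relation U.\<close>

lemma B_rep_points:
  fixes U :: "('b \<times> 'b) set"
  assumes h: "is_B_rep U h"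
  shows "\<exists>t :: nat \<Rightarrow> 'b. \<forall>i j. i \<noteq> j \<longrightarrow> t i \<noteq> t j \<and> (t i, t j) \<in> U"
proof -
  note R = B_rep_basic[OF h]
  obtain x where x: "x \<in> diva" using diva_nonempty by blast
  have "h {None} \<noteq> {}" using R(5)[OF B_ops(1)] by blast
  then obtain s where s: "(s, s) \<in> h {None}" using B_repD(8)[OF h] by (auto simp: Id_on_def)
  have "\<exists>t. (s, t) \<in> h {Some (x, i)}" for i
  proof -
    have P: "{Some (x, i)} \<in> B" using x by simp
    have "{None} \<subseteq> comp {Some (x, i)} {Some (x, i)}" using x by (auto simp: comp_def)
    then have "h {None} \<subseteq> h (comp {Some (x, i)} {Some (x, i)})"
      by (rule R(3)[OF B_ops(1) B_ops(3)[OF P P]])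
    also have "\<dots> = h {Some (x, i)} O h {Some (x, i)}" by (rule B_repD(6)[OF h P P])
    finally show ?thesis using s by blast
  qed
  then obtain t where t: "\<And>i. (s, t i) \<in> h {Some (x, i)}" by metis
  have U: "(s, t i) \<in> U" for i using subsetD[OF B_repD(3)[OF h point_B[OF x]] t] .
  have "t i \<noteq> t j" if "i \<noteq> j" for i j
  proof -
    have "h {Some (x, i)} \<inter> h {Some (x, j)} = {}" using R(4) x that by simp
    then show ?thesis using t[of i] t[of j] by (metis disjoint_iff)
  qed
  moreover have "(t i, t j) \<in> U" for i j
  proof -
    have "sym U" "trans U" using B_repD(1)[OF h] by (auto simp: equiv_def)
    then show ?thesis using U by (meson symD transD)
  qed
  ultimately show ?thesis by blast
qed

text \<open>The relations H x are left abstract so that both a complete representation and a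
  representation of a completion can supply them.\<close>

lemma no_coloured_B_rep:
  fixes U :: "('b \<times> 'b) set"
  assumes h: "is_B_rep U h"
    and cover: "U \<subseteq> Id \<union> (\<Union>x\<in>diva. H x)"
    and free: "\<And>x. x \<in> diva \<Longrightarrow> (H x O H x) \<inter> H x = {}"
  shows False
proof -
  obtain t :: "nat \<Rightarrow> 'b" where t: "\<And>i j. i \<noteq> j \<Longrightarrow> t i \<noteq> t j \<and> (t i, t j) \<in> U"
    using B_rep_points[OF h] by blast
  have "\<exists>x\<in>diva. (t i, t j) \<in> H x" if "i < j" for i j
    using t[of i j] cover that by auto
  then show False by (rule no_triangle_free_colouring[OF finite_K _ free])
qed

section \<open>Algebras without 1-cycles\<close>

context
  assumes nocyc: "no_one_cycles A"
begin

lemma not_cyc: assumes x: "x \<in> diva" shows "\<not> cyc x x x"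
proof
  assume c: "cyc x x x"
  note xa = divaD[OF x]
  have "x \<noteq> idt A"
  proof
    assume "x = idt A"
    then show False using A.atom_le_compl[OF xa(1) A.clos(1)] xa(3) A.le_refl[OF xa(2)] by (simp add: ra_div_def)
  qed
  then have "ra_meet A (cp A x x) x = ra_zero A" using nocyc xa(1) by (simp add: no_one_cycles_def)
  moreover have "ra_le A x (ra_meet A (cp A x x) x)"
    using A.le_meetI[OF c A.le_refl[OF xa(2)]] xa(2) by simp
  ultimately have "x = ra_zero A" using A.le_zeroD xa(2) by simp
  then show False using xa(1) by (simp add: ra_atom_def)
qed

text \<open>Since x;x does not contain x, copies of x never form a triangle, whatever their
  indices.\<close>

lemma B_rep_points_disjoint:
  assumes h: "is_B_rep U h" and x: "x \<in> diva"
  shows "(h {Some (x, i)} O h {Some (x, j)}) \<inter> h {Some (x, k)} = {}"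
proof -
  have "comp {Some (x, i)} {Some (x, j)} \<inter> {Some (x, k)} = {}"
    using not_cyc[OF x] by (auto simp: comp_def)
  then have "h (comp {Some (x, i)} {Some (x, j)}) \<inter> h {Some (x, k)} = {}"
    by (intro B_rep_basic(4)[OF h] B_ops(3)) (use x in simp_all)
  then show ?thesis using B_repD(6)[OF h point_B[OF x] point_B[OF x]] by simp
qed

text \<open>Completeness turns the join of all atoms into a union, so each pair of U lies in some h
  {u}. Merging the copies of each x over all indices leaves finitely many colours.\<close>

lemma BEA_not_completely_representable:
  "\<not> completely_representable_over TYPE('b) (BEA E A)"
proof
  assume "completely_representable_over TYPE('b) (BEA E A)"
  then obtain U :: "('b \<times> 'b) set" and h where hc: "is_complete_representation (BEA E A) U h"
    by (auto simp: completely_representable_over_def)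
  then have h: "is_B_rep U h" by (simp add: is_complete_representation_def)
  let ?S = "(\<lambda>u. {u}) ` pts"
  have "is_sup (BEA E A) ?S pts"
    unfolding is_sup_def BEA_eq restrict_simps using empty_pts_B(2) by blast
  moreover have "?S \<subseteq> car (BEA E A)" using B_singleton by (auto simp: BEA_eq)
  ultimately have "h pts = \<Union>(h ` ?S)" using hc unfolding is_complete_representation_def by blast
  then have U: "U = (\<Union>u\<in>pts. h {u})" using B_rep_basic(2)[OF h] by simp
  define H where "H x = (\<Union>i. h {Some (x, i)})" for x
  have "U \<subseteq> Id \<union> (\<Union>x\<in>diva. H x)"
  proof
    fix q assume "q \<in> U"
    then obtain u where u: "u \<in> pts" "q \<in> h {u}" using U by blast
    show "q \<in> Id \<union> (\<Union>x\<in>diva. H x)"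
    proof (cases u)
      case None
      then show ?thesis using u B_repD(8)[OF h] by auto
    next
      case (Some a)
      then show ?thesis using u by (cases a) (auto simp: H_def)
    qed
  qed
  moreover have "(H x O H x) \<inter> H x = {}" if "x \<in> diva" for x
  proof -
    have "\<not> (p \<in> H x O H x \<and> p \<in> H x)" for p
    proof
      assume "p \<in> H x O H x \<and> p \<in> H x"
      then obtain i j k where "p \<in> h {Some (x, i)} O h {Some (x, j)}" "p \<in> h {Some (x, k)}"
        unfolding H_def by blast
      then show False using B_rep_points_disjoint[OF h that, of i j k] by blast
    qed
    then show ?thesis by blast
  qed
  ultimately show False using no_coloured_B_rep[OF h] by blast
qed

text \<open>A representation of the completion need not preserve infinite joins, so the colour H x
  is the image of the supremum of all copies of x and may contain pairs from no single copy. The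
  universal property of suprema still excludes monochromatic triangles, and density shows that these
  colours and the identity cover U.\<close>

lemma completion_not_representable:
  fixes D :: "'c ra"
  assumes comp: "is_completion (BEA E A) D f"
  shows "\<not> representable_over TYPE('b) D"
proof
  assume "representable_over TYPE('b) D"
  then obtain U :: "('b \<times> 'b) set" and g where g: "is_representation D U g"
    by (auto simp: representable_over_def)
  have emb: "embedding (BEA E A) D f" and raD: "is_ra D" and complete: "complete_ra D"
    and dense: "\<And>d. d \<in> car D \<Longrightarrow> d \<noteq> ra_zero D \<Longrightarrow> \<exists>X\<in>B. f X \<noteq> ra_zero D \<and> ra_le D (f X) d"
    using comp by (simp_all add: is_completion_def BEA_eq)
  from emb have f_inj: "inj_on f B" and "f ` B \<subseteq> car D"
    and f2: "\<forall>X\<in>B. \<forall>Y\<in>B. f (X \<union> Y) = jn D (f X) (f Y) \<and> f (local.comp X Y) = cp D (f X) (f Y)"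
    and f1: "\<forall>X\<in>B. f (pts - X) = cm D (f X) \<and> f X = cv D (f X)" and f_idt: "f {None} = idt D"
    unfolding embedding_def BEA_eq restrict_simps by - (elim conjE, assumption)+
  note f_jn = f2[rule_format, THEN conjunct1] and f_cp = f2[rule_format, THEN conjunct2]
    and f_cm = f1[rule_format, THEN conjunct1] and f_cv = f1[rule_format, THEN conjunct2, symmetric]
  interpret D: rel_alg D using raD by unfold_locales
  from g have gU: "equiv (Field U) U" and g_inj: "inj_on g (car D)" and "\<forall>x\<in>car D. g x \<subseteq> U"
    and "\<forall>x\<in>car D. \<forall>y\<in>car D. g (jn D x y) = g x \<union> g y" and "\<forall>x\<in>car D. g (cm D x) = U - g x"
    and "\<forall>x\<in>car D. \<forall>y\<in>car D. g (cp D x y) = g x O g y"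
    and "\<forall>x\<in>car D. g (cv D x) = (g x)\<inverse>" and g_idt: "g (idt D) = Id_on (Field U)"
    unfolding is_representation_def by - (elim conjE, assumption)+
  note g_sub = this(3)[rule_format] and g_jn = this(4)[rule_format] and g_cm = this(5)[rule_format]
    and g_cp = this(6)[rule_format] and g_cv = this(7)[rule_format]
  have fB: "f X \<in> car D" if "X \<in> B" for X using \<open>f ` B \<subseteq> car D\<close> that by blast
  have g_le: "ra_le D x y \<longleftrightarrow> g x \<subseteq> g y" if "x \<in> car D" "y \<in> car D" for x y
  proof -
    have "ra_le D x y \<longleftrightarrow> g (jn D x y) = g y"
      unfolding ra_le_def using g_inj that by (metis D.clos(4) inj_onD)
    then show ?thesis using g_jn that by auto
  qed
  have g_zero: "g (ra_zero D) = {}"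
    using g_cm[of D.one] g_jn[of "idt D" "cm D (idt D)"] g_cm[of "idt D"] g_sub[of "idt D"]
    unfolding D.zero_eq D.one_def by auto
  define h where "h X = g (f X)" for X
  have h: "is_B_rep U h"
    unfolding is_B_rep_iff h_def
  proof (intro conjI ballI)
    show "inj_on (\<lambda>X. g (f X)) B"
      using inj_onD[OF f_inj] inj_onD[OF g_inj] fB by (intro inj_onI) blast
    show "g (f X) = (g (f X))\<inverse>" if "X \<in> B" for X
      using g_cv[OF fB[OF that]] f_cv[OF that] by simp
  qed (simp_all add: gU g_sub fB f_jn f_cp f_cm f_idt g_jn g_cp g_cm g_idt)
  define F where "F x i = f {Some (x, i)}" for x i
  have F: "F x i \<in> car D" if "x \<in> diva" for x i using fB that by (simp add: F_def)
  have "\<exists>s. is_sup D (range (F x)) s" if "x \<in> diva" for x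
    using complete F[OF that] unfolding complete_ra_def by blast
  then obtain s where s: "\<And>x. x \<in> diva \<Longrightarrow> is_sup D (range (F x)) (s x)" by metis
  define H where "H x = g (s x)" for x
  have sD: "s x \<in> car D" if "x \<in> diva" for x using s[OF that] by (simp add: is_sup_def)
  have gF: "g (F x i) \<subseteq> H x" if "x \<in> diva" for x i
    using s[OF that] g_le[OF F[OF that] sD[OF that]] by (auto simp: is_sup_def H_def)
  have least: "H x \<subseteq> g d" if x: "x \<in> diva" and d: "d \<in> car D" "\<And>i. g (F x i) \<subseteq> g d" for x d
    using s[OF x] g_le[OF F[OF x] d(1)] g_le[OF sD[OF x] d(1)] d unfolding is_sup_def H_def by blast
  have free: "(H x O H x) \<inter> H x = {}" if x: "x \<in> diva" for x
  proof -
    have FF: "(g (F x i) O g (F x j)) \<inter> g (F x k) = {}" for i j k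
      using B_rep_points_disjoint[OF h x] by (simp add: h_def F_def)
    have Fsym: "(g (F x i))\<inverse> = g (F x i)" for i
      using B_repD(7)[OF h point_B[OF x]] by (simp add: h_def F_def)
    have FU: "g (F x i) \<subseteq> U" for i using g_sub F[OF x] by blast
    \<comment> \<open>If every copy of x avoids d, the complement of d is an upper bound of the
      copies, so their supremum avoids d as well.\<close>
    have avoid: "H x \<inter> g d = {}" if d: "d \<in> car D" "\<And>i. g (F x i) \<inter> g d = {}" for d
    proof -
      have "H x \<subseteq> g (cm D d)"
        by (rule least[OF x]) (use d FU g_cm[OF d(1)] in auto)
      then show ?thesis using g_cm[OF d(1)] by blast
    qed
    \<comment> \<open>The supremum replaces the sides of a triangle one at a time: one side in
      \<open>1\<close>, two in \<open>2\<close>, all three at the end. In between, a rotation brings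
      a copy of x back to the third side, where \<open>avoid\<close> applies.\<close>
    have 1: "H x \<inter> (g (F x i) O g (F x j)) = {}" for i j
      using avoid[of "cp D (F x i) (F x j)"] FF g_cp F[OF x] by (simp add: Int_commute)
    have 2: "H x \<inter> (H x O g (F x i)) = {}" for i
    proof -
      have "g (F x j) \<inter> (H x O g (F x i)) = {}" for j
        using 1[of j i] Fsym[of i] by blast
      then show ?thesis
        using avoid[of "cp D (s x) (F x i)"] g_cp[OF sD[OF x] F[OF x]] F[OF x] sD[OF x] by (simp add: H_def)
    qed
    \<comment> \<open>The copies of x are symmetric, so the converse of their supremum is an upper
      bound too; this one inclusion suffices for the last rotation.\<close>
    have Hsym: "H x \<subseteq> (H x)\<inverse>"
    proof -
      have "(g (F x i))\<inverse> \<subseteq> (H x)\<inverse>" for i using gF[OF x] by auto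
      then have "g (F x i) \<subseteq> g (cv D (s x))" for i
        by (simp only: Fsym g_cv[OF sD[OF x]] H_def)
      then have "H x \<subseteq> g (cv D (s x))" by (rule least[OF x D.clos(3)[OF sD[OF x]]])
      then show ?thesis by (simp only: H_def g_cv[OF sD[OF x]])
    qed
    have "g (F x i) \<inter> (H x O H x) = {}" for i
    proof -
      have False if "(a, b) \<in> g (F x i)" "(a, c) \<in> H x" "(c, b) \<in> H x" for a b c
      proof -
        have "(c, a) \<in> H x" using Hsym that(2) by blast
        then have "(c, b) \<in> H x O g (F x i)" using that(1) by blast
        then show False using 2[of i] that(3) by blast
      qed
      then show ?thesis by blast
    qed
    then have "H x \<inter> (H x O H x) = {}"
      using avoid[of "cp D (s x) (s x)"] g_cp[OF sD[OF x] sD[OF x]] sD[OF x] by (simp add: H_def)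
    then show ?thesis by blast
  qed
  \<comment> \<open>There are finitely many diversity atoms, so a finite join is enough, and g
    preserves finite joins.\<close>
  have "\<exists>d\<in>car D. g d = g (idt D) \<union> (\<Union>x\<in>K. H x)" if "finite K" "K \<subseteq> diva" for K
    using that
  proof (induction K rule: finite_induct)
    case empty
    then show ?case by (intro bexI[of _ "idt D"]) simp_all
  next
    case (insert x K)
    then obtain d where "d \<in> car D" "g d = g (idt D) \<union> (\<Union>x\<in>K. H x)" by auto
    then show ?case using insert.prems sD g_jn
      by (intro bexI[of _ "jn D d (s x)"]) (auto simp: H_def)
  qed
  from this[OF finite_K order_refl] obtain d where d: "d \<in> car D" "g d = g (idt D) \<union> (\<Union>x\<in>diva. H x)" by blast
  \<comment> \<open>By density a nonzero complement of d would lie above some f X with X nonempty,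
    hence above f {u} for a point u of X. But f {u} also lies below d, so h {u} would be empty,
    contrary to injectivity.\<close>
  have "cm D d = ra_zero D"
  proof (rule ccontr)
    assume "cm D d \<noteq> ra_zero D"
    then obtain X where X: "X \<in> B" "f X \<noteq> ra_zero D" "ra_le D (f X) (cm D d)"
      using dense[of "cm D d"] d(1) by auto
    have "g (f X) \<subseteq> U - g d" using X(3) g_le[OF fB[OF X(1)]] d(1) g_cm by simp
    moreover have "g (f X) \<noteq> {}"
      using X(2) g_zero g_inj fB[OF X(1)] by (metis D.zero_clos inj_onD)
    moreover have "X \<noteq> {}" using calculation(2) B_rep_basic(1)[OF h] by (auto simp: h_def)
    ultimately obtain u where u: "u \<in> X" by blast
    have up: "u \<in> pts" using u B_ops(5)[OF X(1)] by blast
    have uB: "{u} \<in> B" using B_singleton[OF up] .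
    have "h {u} \<subseteq> h X" using B_rep_basic(3)[OF h uB X(1)] u by blast
    moreover have "h {u} \<subseteq> g d"
    proof (cases u)
      case None
      then show ?thesis using f_idt d(2) by (simp add: h_def)
    next
      case (Some a)
      obtain x i where a: "a = (x, i)" by (cases a)
      then have x: "x \<in> diva" using up Some by simp
      then show ?thesis using gF[OF x, of i] d(2) Some a by (auto simp: h_def F_def)
    qed
    ultimately have "h {u} = {}" using \<open>g (f X) \<subseteq> U - g d\<close> unfolding h_def by blast
    then show False using B_rep_basic(5)[OF h uB] by simp
  qed
  then have "U - g d = {}" using g_cm[OF d(1)] g_zero by simp
  then have "U \<subseteq> Id \<union> (\<Union>x\<in>diva. H x)" 
    unfolding d(2) g_idt by auto
  then show False by (rule no_coloured_B_rep[OF h _ free])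
qed

end

end

theorem theorem2:
  fixes E A :: "'a ra"
  assumes "is_ra E" and "is_ra A"
    and "finite (car E)" and "finite (car A)"
    and "subalgebra E A"
    and "integral E" and "symmetric E" and "integral A" and "symmetric A"
    and "special_extension A E"
    and "has_flexible_trio E"
  shows "(\<forall>S. finite S \<and> S \<subseteq> car (BEA E A) \<longrightarrow>
            (\<exists>D. closed_sub (BEA E A) D \<and> gen_univ (BEA E A) S \<subseteq> D \<and>
                 ra_atomic (restrict_ra (BEA E A) D) \<and>
                 one_point_ext (restrict_ra (BEA E A) D)))
       \<and> representable_over TYPE(nat) (BEA E A)
       \<and> (no_one_cycles A \<longrightarrow>
            \<not> completely_representable_over TYPE('b) (BEA E A) \<and>
            (\<forall>(D::'c ra) f. is_completion (BEA E A) D f \<longrightarrow>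
                \<not> representable_over TYPE('b) D))"
proof -
  interpret special_pair E A using assms by unfold_locales
  show ?thesis
    using finitely_generated_one_point_ext BEA_representable
      BEA_not_completely_representable completion_not_representable by blast
qed

end
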